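(* Let $\theta,\xi,\alpha,\beta$ be real numbers with $0\le\theta,\xi<1$ and $\alpha\beta\neq 0$. Suppose that $T,K,L\ge 1$, $|a_k|\le 1$ and $|b_l|\le 1$. Then $$\int_{0}^{T}\left|\sum_{k\sim K}a_k (k+\theta)^{i\alpha t}\right|^{2}\left|\sum_{l\sim L}b_l (l+\xi)^{i\beta t}\right|^{2}\,dt\ \ll\ (T+KL)\,KL\,(\log T)^{15}.$$
   Context: Here $(a_k)$ and $(b_l)$ are sequences of complex numbers, and $T,K,L$ are real numbers. As usual, $k\sim K$ means that $k$ runs over the integers with $K<k\le 2K$, and likewise $l\sim L$ means $L<l\le 2L$. For real $x>0$ and real $u$, $x^{iu}=e^{iu\log x}$. The notation $X\ll Y$ means $|X|\le cY$ for some constant $c>0$ (the implied constant), which here may depend on $\alpha$ and $\beta$ only.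
   Formalization: The factor (log T)^15 is replaced by (log max(2,T))^15, since the printed bound fails at T=1 (K=L=1, all coefficients 1: the integral is 1, the right side 0); for T≥2 it is unchanged. *)

theory Defs
  imports "HOL-Analysis.Analysis"
begin

definition dyadic :: "real \<Rightarrow> nat set" where
  "dyadic N = {n. N < real n \<and> real n \<le> 2 * N}"

text \<open>Only real $N \ge 1$ is used, so the integers $n \sim N$ are positive and may be taken to be
  natural numbers. The base of the power below is then positive, so the complex \<^term>\<open>(powr)\<close>
  (principal branch) is $e^{iu \log x}$.\<close>

definition dirichlet_sum :: "real \<Rightarrow> real \<Rightarrow> real \<Rightarrow> (nat \<Rightarrow> complex) \<Rightarrow> real \<Rightarrow> complex" where
  "dirichlet_sum \<theta> \<alpha> N c t =
     (\<Sum>n\<in>dyadic N. c n * of_real (real n + \<theta>) powr (\<i> * of_real (\<alpha> * t)))"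

text \<open>The logarithmic factor of the mean value estimate for products of two such sums is taken to be
  \<^term>\<open>ln (max 2 T)\<close> rather than \<^term>\<open>ln T\<close>. For $T \ge 2$ the two agree. For $T$
  near $1$ the estimate with \<^term>\<open>ln T\<close> fails: with $T = K = L = 1$ and all coefficients
  equal to $1$ the integral is $1$, while $\log T = 0$.\<close>

end

theory Submission imports Defs begin

text \<open>Expanding the square against a triangular weight bounds the integral by \<open>T\<close> times the number of
  pairs of frequencies \<open>\<alpha> log (k + \<theta>) + \<beta> log (l + \<xi>)\<close> at distance at most \<open>1/T\<close>. Off the diagonal this
  asks for coincidences, up to \<open>1/T\<close>, between the values \<open>\<alpha> log (1 + h / (k + \<theta>))\<close> and
  \<open>\<beta> log (1 + j / (l + \<xi>))\<close> in a dyadic range \<open>[\<sigma>, 2\<sigma>]\<close>. In the variable \<open>y = 1 / (e\<^bsup>s/\<alpha>\<^esup> - 1)\<close> the number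
  of \<open>(h, k)\<close> with value near \<open>s\<close> is the number of \<open>(h, k)\<close> with \<open>k + \<theta>\<close> near \<open>h y\<close>. Majorizing by a Fejer
  kernel, it is at most its mean of order \<open>K\<^sup>2/T\<close> plus a trigonometric polynomial in \<open>y\<close> with the integer
  frequencies \<open>m h\<close>; orthogonality and a count of the solutions of \<open>m h = m' h'\<close> bound its mean square by
  \<open>\<sigma> K\<^sup>2 log T / T\<close>. Since the means multiply to an admissible term, the fluctuations of the two families
  contribute at most \<open>\<sigma> K L log T\<close> by Cauchy-Schwarz, which sums geometrically over \<open>\<sigma>\<close>. This works
  uniformly in \<open>K\<close>, \<open>L\<close> and \<open>T\<close>, and loses a single logarithm.\<close>

subsection \<open>Equal products and trigonometric polynomials\<close>

text \<open>Two obstacles shape the argument. The logarithm has to depend on \<open>T\<close> alone,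
  although \<open>h\<close> runs up to order \<sigma>\<open>K\<close>: in the count of
  \<open>m h = m' h'\<close> the range of \<open>h\<close> enters only linearly, and only the range
  of \<open>m\<close>, at most \<alpha>\<open>T / 2\<close>, sits under a logarithm. Secondly, a
  mean plus a fluctuation merely majorizes the count, and the fluctuation has no sign, so cross
  terms of a mean with a fluctuation are avoided: the product of two counts is bounded by a mean
  times the other count, whose integral is elementary, plus a product of fluctuations. The factor
  \<sigma> in the mean square, without which the shells could not be summed, comes from the change
  of variables: over a shell \<open>y\<close> covers on the order of \<open>1 /\<close>\<sigma>
  periods at a speed of order \<open>1 / \<sigma>\<^sup>2\<close>. The shells stop at \<sigma> of
  order \<open>1 / T\<close>, where the windows would reach the pole of \<open>y\<close> at
  \<open>s = 0\<close>; the gaps that remain are few enough to be counted directly.\<close>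

lemma sum_inverse_max_square_le:
  "(\<Sum>a\<in>{1..N::nat}. \<Sum>b\<in>{1..N}. 1 / (real (max a b))\<^sup>2) \<le> 2 * (1 + ln (real N))"
proof -
  have harm: "(\<Sum>a\<in>{1..N}. 1 / real a) \<le> 1 + ln (real N)"
  proof (cases "N = 0")
    case False
    then obtain n where n: "N = Suc n" by (cases N) auto
    have "harm (Suc n) - ln (real (Suc n)) \<le> harm (Suc 0) - ln (real (Suc 0))"
      using decseq_harm_diff_ln unfolding decseq_def by blast
    then show ?thesis by (simp add: n harm_def inverse_eq_divide)
  qed simp
  \<comment> \<open>Splitting by the larger index leaves \<open>a\<close> terms of size
    \<open>1 / a\<^sup>2\<close>, hence a harmonic sum. The two halves overlap on the diagonal,
    which only costs in the favourable direction.\<close>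
  have lower: "(\<Sum>b\<in>{1..N}. if b \<le> a then 1 / (real a)\<^sup>2 else 0) \<le> 1 / real a" if "a \<in> {1..N}" for a
  proof -
    have "(\<Sum>b\<in>{1..N}. if b \<le> a then 1 / (real a)\<^sup>2 else 0) = (\<Sum>b\<in>{1..a}. 1 / (real a)\<^sup>2)"
      by (rule sum.mono_neutral_cong_right) (use that in auto)
    also have "\<dots> = 1 / real a"
      using that by (simp add: power2_eq_square)
    finally show ?thesis by simp
  qed
  have "(\<Sum>a\<in>{1..N}. \<Sum>b\<in>{1..N}. 1 / (real (max a b))\<^sup>2)
      \<le> (\<Sum>a\<in>{1..N}. \<Sum>b\<in>{1..N}. (if b \<le> a then 1 / (real a)\<^sup>2 else 0) + (if a \<le> b then 1 / (real b)\<^sup>2 else 0))"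
    by (intro sum_mono) (auto simp: max_def)
  also have "\<dots> = (\<Sum>a\<in>{1..N}. \<Sum>b\<in>{1..N}. if b \<le> a then 1 / (real a)\<^sup>2 else 0)
      + (\<Sum>a\<in>{1..N}. \<Sum>b\<in>{1..N}. if a \<le> b then 1 / (real b)\<^sup>2 else 0)"
    by (simp add: sum.distrib)
  also have "(\<Sum>a\<in>{1..N}. \<Sum>b\<in>{1..N}. if a \<le> b then 1 / (real b)\<^sup>2 else 0)
      = (\<Sum>a\<in>{1..N}. \<Sum>b\<in>{1..N}. if b \<le> a then 1 / (real a)\<^sup>2 else 0)"
    by (rule sum.swap)
  also have "(\<Sum>a\<in>{1..N}. \<Sum>b\<in>{1..N}. if b \<le> a then 1 / (real a)\<^sup>2 else 0) \<le> (\<Sum>a\<in>{1..N}. 1 / real a)"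
    by (intro sum_mono lower)
  finally show ?thesis using harm by simp
qed

text \<open>Reducing \<open>h / h'\<close> to lowest terms \<open>a / b\<close> forces
  \<open>h = g a\<close>, \<open>h' = g b\<close>, \<open>m = e b\<close>, \<open>m' = e a\<close>,
  so each coprime pair admits at most \<open>H N / (max a b)\<^sup>2\<close> solutions. Since
  \<open>a\<close> and \<open>b\<close> divide \<open>m'\<close> and \<open>m\<close>, they are
  bounded by \<open>N\<close>, and the logarithm sees \<open>N\<close> but not
  \<open>H\<close>.\<close>

lemma card_equal_products_le:
  fixes H N :: nat
  shows "real (card {(p, q). p \<in> {1..H} \<times> {1..N} \<and> q \<in> {1..H} \<times> {1..N} \<and> fst p * snd p = fst q * snd q})
    \<le> 2 * real H * real N * (1 + ln (real N))" (is "real (card ?S) \<le> _")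
proof -
  let ?D = "SIGMA x : {1..N} \<times> {1..N}. {1..H div max (fst x) (snd x)} \<times> {1..N div max (fst x) (snd x)}"
  let ?f = "\<lambda>((a, b), (g, e)). ((g * a, e * b), (g * b, e * a)) :: (nat \<times> nat) \<times> (nat \<times> nat)"
  have "?S \<subseteq> ?f ` ?D"
  proof
    fix z assume "z \<in> ?S"
    then obtain h m h' m' where z: "z = ((h, m), (h', m'))"
      and h: "h \<ge> 1" "h \<le> H" "h' \<ge> 1" "h' \<le> H" and m: "m \<ge> 1" "m \<le> N" "m' \<ge> 1" "m' \<le> N"
      and eq: "h * m = h' * m'"
      by (cases z) auto
    define g where "g = gcd h h'"
    have g: "g \<ge> 1" using h by (simp add: g_def Suc_le_eq)
    obtain a b where ab: "h = g * a" "h' = g * b" "coprime a b"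
      using gcd_coprime_exists[of h h'] g unfolding g_def[symmetric] by (auto simp: mult.commute)
    have amb: "a * m = b * m'" using eq g by (simp add: ab(1,2))
    then have "b dvd a * m" by simp
    then have "b dvd m" using ab(3)
      by (simp add: coprime_commute coprime_dvd_mult_right_iff)
    then obtain e where e: "m = e * b" by (metis dvd_def mult.commute)
    have b: "b \<ge> 1" "a \<ge> 1" "e \<ge> 1"
      using h(1,3) m(1) unfolding ab(1,2) e by (simp_all add: Suc_le_eq)
    have e': "m' = e * a" using amb b by (simp add: e) (simp add: mult.commute)
    have "a \<le> m'" "b \<le> m" using e e' b by auto
    moreover have "g \<le> H div max a b" "e \<le> N div max a b"
      using h m unfolding ab e e' using b by (simp_all add: max_def less_eq_div_iff_mult_less_eq)
    ultimately have "((a, b), (g, e)) \<in> ?D"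
      using b g \<open>m' \<le> N\<close> \<open>m \<le> N\<close> by (simp del: max.bounded_iff)
    moreover have "z = ?f ((a, b), (g, e))" by (simp add: z ab(1,2) e e')
    ultimately show "z \<in> ?f ` ?D" by (rule rev_image_eqI)
  qed
  then have "card ?S \<le> card (?f ` ?D)"
    by (intro card_mono finite_imageI finite_SigmaI) auto
  also have "\<dots> \<le> card ?D" by (intro card_image_le finite_SigmaI) auto
  also have "card ?D = (\<Sum>x\<in>{1..N} \<times> {1..N}. (H div max (fst x) (snd x)) * (N div max (fst x) (snd x)))"
    by (subst card_SigmaI) (auto simp: card_cartesian_product)
  finally have "real (card ?S) \<le> (\<Sum>x\<in>{1..N} \<times> {1..N}. real (H div max (fst x) (snd x)) * real (N div max (fst x) (snd x)))"
    unfolding of_nat_mult[symmetric] of_nat_sum[symmetric] of_nat_le_iff .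
  also have "\<dots> \<le> (\<Sum>x\<in>{1..N} \<times> {1..N}. (real H / real (max (fst x) (snd x))) * (real N / real (max (fst x) (snd x))))"
    by (intro sum_mono mult_mono) (auto intro: of_nat_div_le_of_nat simp del: of_nat_max)
  also have "\<dots> = real H * real N * (\<Sum>x\<in>{1..N} \<times> {1..N}. 1 / (real (max (fst x) (snd x)))\<^sup>2)"
    unfolding sum_distrib_left by (intro sum.cong refl) (simp add: power2_eq_square)
  also have "\<dots> = real H * real N * (\<Sum>a\<in>{1..N}. \<Sum>b\<in>{1..N}. 1 / (real (max a b))\<^sup>2)"
    unfolding sum.cartesian_product case_prod_beta ..
  also have "\<dots> \<le> real H * real N * (2 * (1 + ln (real N)))"
    by (intro mult_left_mono sum_inverse_max_square_le) auto
  finally show ?thesis by (simp add: mult_ac)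
qed

lemma has_integral_cos_period:
  fixes n :: int and N :: nat and \<psi> :: real
  shows "((\<lambda>y. cos (\<psi> - 2 * pi * of_int n * y)) has_integral (if n = 0 then real N * cos \<psi> else 0)) {0..real N}"
proof (cases "n = 0")
  case True
  then show ?thesis using has_integral_const_real[of "cos \<psi>" 0 "real N"] by simp
next
  case False
  let ?F = "\<lambda>y. - sin (\<psi> - 2 * pi * of_int n * y) / (2 * pi * of_int n)"
  have "((\<lambda>y. cos (\<psi> - 2 * pi * of_int n * y)) has_integral (?F (real N) - ?F 0)) {0..real N}"
  proof (rule fundamental_theorem_of_calculus)
    fix y :: real
    show "(?F has_vector_derivative cos (\<psi> - 2 * pi * of_int n * y)) (at y within {0..real N})"
      unfolding has_real_derivative_iff_has_vector_derivative[symmetric]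
      by (rule derivative_eq_intros refl | simp add: False)+
  qed simp
  moreover have "sin (\<psi> - 2 * pi * of_int n * real N) = sin \<psi>"
  proof -
    have eq: "2 * pi * of_int n * real N = 2 * pi * of_int (n * int N)" by simp
    show ?thesis unfolding eq sin_diff cos_int_2pin sin_int_2pin by simp
  qed
  ultimately show ?thesis using False by simp
qed

text \<open>Each product of cosines splits into a difference and a sum frequency. The sum frequency
  never vanishes because \<open>f i >= 1\<close>, so only equal frequencies survive; coefficients
  and phases are then bounded trivially.\<close>

lemma integral_cos_sum_square_le:
  fixes f :: "'a \<Rightarrow> nat" and N :: nat and c \<phi> :: "'a \<Rightarrow> real"
  assumes fin: "finite I" and f: "\<And>i. i \<in> I \<Longrightarrow> f i \<ge> 1" and c: "\<And>i. i \<in> I \<Longrightarrow> \<bar>c i\<bar> \<le> 1"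
  shows "integral {0..real N} (\<lambda>y. (\<Sum>i\<in>I. c i * cos (\<phi> i - 2 * pi * real (f i) * y))\<^sup>2)
    \<le> real N * real (card {(i, j). i \<in> I \<and> j \<in> I \<and> f i = f j})"
proof -
  let ?J = "\<lambda>i j. c i * c j * ((if f i = f j then real N * cos (\<phi> i - \<phi> j) else 0) / 2)"
  have pair: "((\<lambda>y. c i * cos (\<phi> i - 2 * pi * real (f i) * y) * (c j * cos (\<phi> j - 2 * pi * real (f j) * y)))
      has_integral ?J i j) {0..real N}" if "i \<in> I" "j \<in> I" for i j
  proof -
    have 1: "((\<lambda>y. cos ((\<phi> i - \<phi> j) - 2 * pi * of_int (int (f i) - int (f j)) * y)) has_integral
        (if f i = f j then real N * cos (\<phi> i - \<phi> j) else 0)) {0..real N}"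
      using has_integral_cos_period[of "\<phi> i - \<phi> j" "int (f i) - int (f j)" N] by simp
    have 2: "((\<lambda>y. cos ((\<phi> i + \<phi> j) - 2 * pi * of_int (int (f i) + int (f j)) * y)) has_integral 0) {0..real N}"
      using has_integral_cos_period[of "\<phi> i + \<phi> j" "int (f i) + int (f j)" N] f[OF that(1)] by simp
    have "((\<lambda>y. c i * c j * ((cos ((\<phi> i - \<phi> j) - 2 * pi * of_int (int (f i) - int (f j)) * y)
        + cos ((\<phi> i + \<phi> j) - 2 * pi * of_int (int (f i) + int (f j)) * y)) / 2)) has_integral ?J i j) {0..real N}"
      by (intro has_integral_mult_right has_integral_divide)
         (use has_integral_add[OF 1 2] in simp)
    moreover have eq: "c i * c j * ((cos ((\<phi> i - \<phi> j) - 2 * pi * of_int (int (f i) - int (f j)) * y)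
        + cos ((\<phi> i + \<phi> j) - 2 * pi * of_int (int (f i) + int (f j)) * y)) / 2)
        = c i * cos (\<phi> i - 2 * pi * real (f i) * y) * (c j * cos (\<phi> j - 2 * pi * real (f j) * y))" for y
      using cos_times_cos[of "\<phi> i - 2 * pi * real (f i) * y" "\<phi> j - 2 * pi * real (f j) * y"]
      by (simp add: algebra_simps)
    ultimately show ?thesis by (simp only: eq)
  qed
  have "((\<lambda>y. \<Sum>i\<in>I. \<Sum>j\<in>I. c i * cos (\<phi> i - 2 * pi * real (f i) * y) * (c j * cos (\<phi> j - 2 * pi * real (f j) * y)))
      has_integral (\<Sum>i\<in>I. \<Sum>j\<in>I. ?J i j)) {0..real N}"
    by (intro has_integral_sum fin pair)
  then have "integral {0..real N} (\<lambda>y. (\<Sum>i\<in>I. c i * cos (\<phi> i - 2 * pi * real (f i) * y))\<^sup>2) = (\<Sum>i\<in>I. \<Sum>j\<in>I. ?J i j)"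
    by (simp add: power2_eq_square sum_product integral_unique)
  also have "\<dots> \<le> (\<Sum>i\<in>I. \<Sum>j\<in>I. if f i = f j then real N else 0)"
  proof (intro sum_mono)
    fix i j assume ij: "i \<in> I" "j \<in> I"
    have "\<bar>c i * c j * (cos (\<phi> i - \<phi> j) / 2)\<bar> \<le> 1 * 1 * 1"
      unfolding abs_mult using c[OF ij(1)] c[OF ij(2)] abs_cos_le_one[of "\<phi> i - \<phi> j"]
      by (intro mult_mono) (auto simp del: abs_cos_le_one)
    then have "c i * c j * (cos (\<phi> i - \<phi> j) / 2) \<le> 1" by linarith
    then have "real N * (c i * c j * (cos (\<phi> i - \<phi> j) / 2)) \<le> real N * 1"
      by (intro mult_left_mono) auto
    then show "?J i j \<le> (if f i = f j then real N else 0)" by (simp add: mult_ac)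
  qed
  also have "\<dots> = (\<Sum>(i, j)\<in>I \<times> I. if f i = f j then real N else 0)"
    by (simp add: sum.cartesian_product)
  also have "\<dots> = (\<Sum>(i, j)\<in>{(i, j). i \<in> I \<and> j \<in> I \<and> f i = f j}. real N)"
    by (rule sum.mono_neutral_cong_right) (auto simp: fin split: if_splits)
  also have "\<dots> = real N * real (card {(i, j). i \<in> I \<and> j \<in> I \<and> f i = f j})"
    by (simp add: case_prod_beta)
  finally show ?thesis .
qed

section \<open>The Fejer kernel\<close>

text \<open>Normalized to mean value 1 over a period, with peak value \<open>M\<close> at the
  integers.\<close>

definition fejer :: "nat \<Rightarrow> real \<Rightarrow> real" where
  "fejer M v = (norm (\<Sum>m<M. cis (2 * pi * real m * v)))\<^sup>2 / real M"

lemma norm_add_squared_complex: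
  "(norm (z + w))\<^sup>2 = (norm z)\<^sup>2 + (norm w)\<^sup>2 + 2 * Re (z * cnj w)"
  unfolding cmod_power2 by (simp add: power2_eq_square algebra_simps)

text \<open>Adjoining the frequency \<open>M\<close> creates each difference
  \<open>1, ..., M\<close> exactly once, so in the induction every coefficient \<open>M - m\<close>
  grows by one.\<close>

lemma norm_sum_cis_square:
  "(norm (\<Sum>m<M. cis (2 * pi * real m * v)))\<^sup>2
    = real M + 2 * (\<Sum>m\<in>{1..<M}. (real M - real m) * cos (2 * pi * real m * v))"
proof (induction M)
  case (Suc M)
  let ?D = "\<Sum>m<M. cis (2 * pi * real m * v)"
  have cross: "Re (?D * cnj (cis (2 * pi * real M * v))) = (\<Sum>m\<in>{1..M}. cos (2 * pi * real m * v))"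
  proof -
    have "Re (?D * cnj (cis (2 * pi * real M * v))) = (\<Sum>m<M. cos (2 * pi * real m * v - 2 * pi * real M * v))"
      by (simp add: sum_distrib_right cis_cnj cis_mult)
    also have "\<dots> = (\<Sum>m\<in>{1..M}. cos (2 * pi * real m * v))"
    proof (rule sum.reindex_bij_witness[of _ "\<lambda>m. M - m" "\<lambda>m. M - m"])
      fix m assume "m \<in> {..<M}"
      then have "2 * pi * real m * v - 2 * pi * real M * v = - (2 * pi * real (M - m) * v)"
        by (simp add: algebra_simps of_nat_diff)
      then show "cos (2 * pi * real (M - m) * v) = cos (2 * pi * real m * v - 2 * pi * real M * v)"
        by simp
    qed auto
    finally show ?thesis .
  qed
  have "(norm (\<Sum>m<Suc M. cis (2 * pi * real m * v)))\<^sup>2 = (norm ?D)\<^sup>2 + 1 + 2 * Re (?D * cnj (cis (2 * pi * real M * v)))"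
    unfolding sum.lessThan_Suc norm_add_squared_complex by simp
  also have "\<dots> = real M + 1 + 2 * (\<Sum>m\<in>{1..<M}. (real M - real m) * cos (2 * pi * real m * v))
      + 2 * (\<Sum>m\<in>{1..M}. cos (2 * pi * real m * v))"
    unfolding cross Suc.IH by simp
  \<comment> \<open>The term \<open>m = M\<close> may be added because its coefficient
    vanishes.\<close>
  also have "(\<Sum>m\<in>{1..<M}. (real M - real m) * cos (2 * pi * real m * v))
      = (\<Sum>m\<in>{1..M}. (real M - real m) * cos (2 * pi * real m * v))"
    by (rule sum.mono_neutral_left) auto
  also have "real M + 1 + 2 * \<dots> + 2 * (\<Sum>m\<in>{1..M}. cos (2 * pi * real m * v))
      = real (Suc M) + 2 * (\<Sum>m\<in>{1..<Suc M}. (real (Suc M) - real m) * cos (2 * pi * real m * v))"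
    by (simp add: sum.distrib[symmetric] sum_distrib_left atLeastLessThanSuc_atLeastAtMost) (simp add: algebra_simps sum.distrib sum_distrib_left sum_subtractf)
  finally show ?case .
qed simp

lemma fejer_eq:
  assumes "M \<ge> 1"
  shows "fejer M v = 1 + 2 * (\<Sum>m\<in>{1..<M}. (1 - real m / real M) * cos (2 * pi * real m * v))"
proof -
  have "fejer M v = 1 + 2 * ((\<Sum>m\<in>{1..<M}. (real M - real m) * cos (2 * pi * real m * v)) / real M)"
    using assms by (simp add: fejer_def norm_sum_cis_square add_divide_distrib)
  also have "(\<Sum>m\<in>{1..<M}. (real M - real m) * cos (2 * pi * real m * v)) / real M
      = (\<Sum>m\<in>{1..<M}. (1 - real m / real M) * cos (2 * pi * real m * v))"
    using assms unfolding sum_divide_distrib by (intro sum.cong) (auto simp: field_simps)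
  finally show ?thesis .
qed

lemma fejer_nonneg: "fejer M v \<ge> 0"
  by (simp add: fejer_def)

text \<open>Within \<open>1 / (6 M)\<close> of an integer all phases stay within
  \<open>pi / 3\<close> of a multiple of \<open>2 pi\<close>, so each of the \<open>M\<close>
  exponentials has real part at least \<open>1 / 2\<close>.\<close>

lemma fejer_ge:
  fixes k :: int
  assumes v: "\<bar>v - of_int k\<bar> * real M \<le> 1 / 6" and M: "M \<ge> 1"
  shows "fejer M v \<ge> real M / 4"
proof -
  have "real M / 2 = (\<Sum>m<M. 1 / 2 :: real)" by simp
  also have "\<dots> \<le> (\<Sum>m<M. cos (2 * pi * real m * v))"
  proof (intro sum_mono)
    fix m assume "m \<in> {..<M}"
    then have "real m * \<bar>v - of_int k\<bar> \<le> 1 / 6"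
      using v mult_right_mono[of "real m" "real M" "\<bar>v - of_int k\<bar>"] by (simp add: mult.commute)
    then have le: "\<bar>2 * pi * real m * (v - of_int k)\<bar> \<le> pi / 3"
      unfolding abs_mult using mult_left_mono[of "real m * \<bar>v - of_int k\<bar>" "1/6" "2 * pi"] by (simp add: mult.assoc)
    have "cos (pi / 3) \<le> cos \<bar>2 * pi * real m * (v - of_int k)\<bar>"
      by (rule cos_monotone_0_pi_le) (use le in auto)
    moreover have "cos (2 * pi * real m * v) = cos (2 * pi * real m * (v - of_int k))"
    proof -
      have "2 * pi * real m * v = 2 * pi * real m * (v - of_int k) + 2 * pi * of_int (int m * k)"
        by (simp add: algebra_simps)
      then show ?thesis by (simp only: cos_add cos_int_2pin sin_int_2pin mult_1_right mult_zero_right diff_zero)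
    qed
    ultimately show "1 / 2 \<le> cos (2 * pi * real m * v)" by (simp add: cos_60)
  qed
  also have "\<dots> = Re (\<Sum>m<M. cis (2 * pi * real m * v))" by simp
  also have "\<dots> \<le> norm (\<Sum>m<M. cis (2 * pi * real m * v))" by (rule complex_Re_le_cmod)
  finally have "(real M / 2)\<^sup>2 \<le> (norm (\<Sum>m<M. cis (2 * pi * real m * v)))\<^sup>2"
    by (intro power_mono) auto
  then show ?thesis using M by (simp add: fejer_def field_simps power2_eq_square)
qed

subsection \<open>Gaps of shifted logarithms\<close>

lemma card_nat_interval_le:
  fixes a b :: real
  assumes "a \<le> b"
  shows "finite {k::nat. a \<le> real k \<and> real k \<le> b}"
    and "real (card {k::nat. a \<le> real k \<and> real k \<le> b}) \<le> b - a + 1"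
proof -
  have sub: "{k::nat. a \<le> real k \<and> real k \<le> b} \<subseteq> nat ` {\<lceil>a\<rceil>..\<lfloor>b\<rfloor>}"
  proof
    fix k assume "k \<in> {k::nat. a \<le> real k \<and> real k \<le> b}"
    then have "int k \<in> {\<lceil>a\<rceil>..\<lfloor>b\<rfloor>}" by (simp add: ceiling_le_iff le_floor_iff)
    then show "k \<in> nat ` {\<lceil>a\<rceil>..\<lfloor>b\<rfloor>}" by (metis imageI nat_int)
  qed
  then show "finite {k::nat. a \<le> real k \<and> real k \<le> b}"
    by (rule finite_subset) simp
  have "card {k::nat. a \<le> real k \<and> real k \<le> b} \<le> card (nat ` {\<lceil>a\<rceil>..\<lfloor>b\<rfloor>})"
    using sub by (intro card_mono) auto
  also have "\<dots> \<le> card {\<lceil>a\<rceil>..\<lfloor>b\<rfloor>}" by (rule card_image_le) simp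
  also have "\<dots> = nat (\<lfloor>b\<rfloor> - \<lceil>a\<rceil> + 1)" by simp
  finally have "real (card {k::nat. a \<le> real k \<and> real k \<le> b}) \<le> real (nat (\<lfloor>b\<rfloor> - \<lceil>a\<rceil> + 1))"
    by simp
  also have "\<dots> \<le> b - a + 1" using assms by linarith
  finally show "real (card {k::nat. a \<le> real k \<and> real k \<le> b}) \<le> b - a + 1" .
qed

text \<open>For \<eta>\<open><= 1 / 16\<close> the window holds at most one integer, and the choice
  of \<open>M\<close> puts the argument within \<open>1 / (8 M)\<close> of an integer, where the
  kernel is at least \<open>M / 4\<close>; then \<open>16 \<eta> M >= 1\<close> because
  \<open>8 \<eta> M >= 1 - 8 \<eta>\<close>. For larger \<eta> one has \<open>M = 1\<close>, the
  kernel is constantly 1, and the trivial count \<open>2 \<eta> + 1\<close> suffices.\<close>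

lemma card_near_le_fejer:
  fixes \<theta> v \<eta> :: real
  assumes \<eta>: "\<eta> > 0" and M_def: "M = max 1 (nat \<lfloor>1 / (8 * \<eta>)\<rfloor>)"
  shows "finite {k::nat. \<bar>real k + \<theta> - v\<bar> \<le> \<eta>}"
    and "real (card {k::nat. \<bar>real k + \<theta> - v\<bar> \<le> \<eta>}) \<le> 64 * \<eta> * fejer M (\<theta> - v)"
proof -
  have eq: "{k::nat. \<bar>real k + \<theta> - v\<bar> \<le> \<eta>} = {k. v - \<theta> - \<eta> \<le> real k \<and> real k \<le> v - \<theta> + \<eta>}"
    by auto
  show "finite {k::nat. \<bar>real k + \<theta> - v\<bar> \<le> \<eta>}"
    unfolding eq using \<eta> by (intro card_nat_interval_le) simp
  have card: "real (card {k::nat. \<bar>real k + \<theta> - v\<bar> \<le> \<eta>}) \<le> 2 * \<eta> + 1"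
    unfolding eq using card_nat_interval_le(2)[of "v - \<theta> - \<eta>" "v - \<theta> + \<eta>"] \<eta> by simp
  show "real (card {k::nat. \<bar>real k + \<theta> - v\<bar> \<le> \<eta>}) \<le> 64 * \<eta> * fejer M (\<theta> - v)"
  proof (cases "\<eta> > 1 / 16")
    case True
    then have "1 / (8 * \<eta>) < 2" using \<eta> by (simp add: field_simps)
    then have "M = 1" unfolding M_def by linarith
    then have "fejer M (\<theta> - v) = 1" by (simp add: fejer_eq)
    then show ?thesis using card True by simp
  next
    case False
    then have "1 / (8 * \<eta>) \<ge> 2" using \<eta> by (simp add: field_simps)
    then have "real M \<le> 1 / (8 * \<eta>)" "real M \<ge> 1 / (8 * \<eta>) - 1" "M \<ge> 1"
      unfolding M_def by linarith+
    then have M: "8 * \<eta> * real M \<le> 1" "8 * \<eta> * real M \<ge> 1 - 8 * \<eta>"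
      using \<eta> by (simp_all add: field_simps)
    show ?thesis
    proof (cases "{k::nat. \<bar>real k + \<theta> - v\<bar> \<le> \<eta>} = {}")
      case True
      then show ?thesis using fejer_nonneg[of M "\<theta> - v"] \<eta> by simp
    next
      case ne: False
      then obtain k where k: "\<bar>real k + \<theta> - v\<bar> \<le> \<eta>" by auto
      have "\<bar>\<theta> - v - of_int (- int k)\<bar> * real M \<le> \<eta> * real M"
        using k by (intro mult_right_mono) auto
      also have "\<dots> \<le> 1 / 6" using M(1) by simp
      finally have "fejer M (\<theta> - v) \<ge> real M / 4" using \<open>M \<ge> 1\<close> by (rule fejer_ge)
      then have "64 * \<eta> * fejer M (\<theta> - v) \<ge> 64 * \<eta> * (real M / 4)" using \<eta> by (intro mult_left_mono) auto
      moreover have "64 * \<eta> * (real M / 4) = 2 * (8 * \<eta> * real M)" by simp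
      ultimately have "64 * \<eta> * fejer M (\<theta> - v) \<ge> 1" using M(2) False by linarith
      moreover have "real (card {k::nat. \<bar>real k + \<theta> - v\<bar> \<le> \<eta>}) < 2" using card False by linarith
      then have "card {k::nat. \<bar>real k + \<theta> - v\<bar> \<le> \<eta>} \<le> 1" by linarith
      ultimately show ?thesis by linarith
    qed
  qed
qed

lemma abs_exp_diff_le:
  fixes a b c :: real
  assumes "a \<le> c" "b \<le> c"
  shows "\<bar>exp a - exp b\<bar> \<le> exp c * \<bar>a - b\<bar>"
proof -
  have *: "exp a - exp b \<le> exp c * \<bar>a - b\<bar>" if "a \<le> c" for a b :: real
  proof -
    have "exp a - exp b = exp a * (1 - exp (b - a))" by (simp add: algebra_simps flip: exp_add)
    also have "\<dots> \<le> exp a * (a - b)"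
      using exp_ge_add_one_self[of "b - a"] by (intro mult_left_mono) (linarith, simp)
    also have "\<dots> \<le> exp a * \<bar>a - b\<bar>" by (intro mult_left_mono) auto
    also have "\<dots> \<le> exp c * \<bar>a - b\<bar>" using that by (intro mult_right_mono) auto
    finally show ?thesis .
  qed
  show ?thesis using *[OF assms(1), of b] *[OF assms(2), of a] by (simp add: abs_le_iff abs_minus_commute)
qed

text \<open>The singularity of \<open>1 / (exp x - 1)\<close> at 0 is carried by
  \<open>1 / (a * b)\<close>, through \<open>exp x - 1 >= x\<close>. A window of width \<rho> around
  \<open>s\<close> of size \<sigma> thus becomes one of width of order
  \<open>\<rho> / \<sigma>\<^sup>2\<close> in \<open>y\<close>.\<close>

lemma inverse_exp_diff_le:
  fixes a b c :: real
  assumes "0 < a" "a \<le> c" "0 < b" "b \<le> c"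
  shows "\<bar>1 / (exp a - 1) - 1 / (exp b - 1)\<bar> \<le> exp c * \<bar>a - b\<bar> / (a * b)"
proof -
  have ea: "exp a - 1 \<ge> a" and eb: "exp b - 1 \<ge> b"
    using exp_ge_add_one_self[of a] exp_ge_add_one_self[of b] by linarith+
  then have pos: "exp a - 1 > 0" "exp b - 1 > 0" using assms by linarith+
  have "1 / (exp a - 1) - 1 / (exp b - 1) = (exp b - exp a) / ((exp a - 1) * (exp b - 1))"
    using pos by (simp add: field_simps)
  then have "\<bar>1 / (exp a - 1) - 1 / (exp b - 1)\<bar> = \<bar>exp a - exp b\<bar> / ((exp a - 1) * (exp b - 1))"
    using pos by (simp add: abs_mult abs_minus_commute)
  also have "\<dots> \<le> (exp c * \<bar>a - b\<bar>) / (a * b)"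
    using assms ea eb pos by (intro frac_le abs_exp_diff_le mult_mono) auto
  finally show ?thesis .
qed

section \<open>Gaps inside a dyadic block and their window counts\<close>

definition gap_pairs :: "real \<Rightarrow> (nat \<times> nat) set" where
  "gap_pairs K = {(h, k). 1 \<le> h \<and> k \<in> dyadic K \<and> k + h \<in> dyadic K}"

text \<open>This is \<alpha> times the difference of the logarithms of
  \<open>k + h +\<close>\<theta> and \<open>k +\<close>\<theta>. In terms of the quotient it can be
  solved for \<open>(k + \<theta>) / h\<close>, which gives the variable \<open>y\<close>.\<close>

definition gap_log :: "real \<Rightarrow> real \<Rightarrow> nat \<times> nat \<Rightarrow> real" where
  "gap_log \<alpha> \<theta> p = \<alpha> * ln (1 + real (fst p) / (real (snd p) + \<theta>))"

text \<open>A sum of indicators in \<open>s\<close> instead of a cardinality, so that it and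
  products of two such counts can be integrated term by term.\<close>

definition window_count :: "real \<Rightarrow> real \<Rightarrow> real \<Rightarrow> real \<Rightarrow> real \<Rightarrow> real" where
  "window_count \<alpha> \<theta> K \<rho> s =
     (\<Sum>p\<in>gap_pairs K. indicator {gap_log \<alpha> \<theta> p - \<rho>..gap_log \<alpha> \<theta> p + \<rho>} s)"

lemma finite_dyadic [simp]: "finite (dyadic K)"
proof -
  have "dyadic K \<subseteq> {..nat \<lfloor>2 * K\<rfloor>}"
    by (auto simp: dyadic_def) linarith
  then show ?thesis by (rule finite_subset) simp
qed

lemma finite_gap_pairs [simp]: "finite (gap_pairs K)"
proof -
  have "gap_pairs K \<subseteq> {..nat \<lfloor>2 * K\<rfloor>} \<times> {..nat \<lfloor>2 * K\<rfloor>}"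
    by (auto simp: gap_pairs_def dyadic_def) linarith+
  then show ?thesis by (rule finite_subset) simp
qed

text \<open>With \<open>x = h / (k + \<theta>)\<close>, the logarithm lies between
  \<open>x / (1 + x) = h / (k + h + \<theta>)\<close> and \<open>x\<close>. The denominator is at
  most \<open>3 K\<close> since \<theta>\<open>< 1 <= K\<close>, and \<open>x < 1\<close> since
  \<open>h < K < k\<close>.\<close>

lemma gap_log_bounds:
  assumes p: "(h, k) \<in> gap_pairs K" and K: "K \<ge> 1" and \<theta>: "0 \<le> \<theta>" "\<theta> < 1" and \<alpha>: "\<alpha> > 0"
  shows "\<alpha> * real h / (3 * K) \<le> gap_log \<alpha> \<theta> (h, k)" "gap_log \<alpha> \<theta> (h, k) < \<alpha>"
    "gap_log \<alpha> \<theta> (h, k) > 0" "h \<ge> 1" "real k + \<theta> > 0"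
    "exp (gap_log \<alpha> \<theta> (h, k) / \<alpha>) - 1 = real h / (real k + \<theta>)"
proof -
  have h: "h \<ge> 1" and k: "K < real k" "real k + real h \<le> 2 * K"
    using p by (auto simp: gap_pairs_def dyadic_def)
  show "h \<ge> 1" by (rule h)
  have k0: "real k + \<theta> > 0" using k K \<theta> by linarith
  then show "real k + \<theta> > 0" .
  define x where "x = real h / (real k + \<theta>)"
  have x: "0 < x" "x < 1" using h k k0 \<theta> by (auto simp: x_def field_simps)
  have g: "gap_log \<alpha> \<theta> (h, k) = \<alpha> * ln (1 + x)" by (simp add: gap_log_def x_def)
  have "real h / (3 * K) \<le> real h / (real k + \<theta> + real h)"
    using k K \<theta> k0 h by (intro divide_left_mono mult_pos_pos) auto
  also have "\<dots> = x / (1 + x)" using k0 by (simp add: x_def add_divide_eq_if_simps)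
  also have "\<dots> = 1 - 1 / (1 + x)" using x by (simp add: field_simps)
  also have "\<dots> \<le> ln (1 + x)"
    using ln_le_minus_one[of "1 / (1 + x)"] x by (simp add: ln_div)
  finally have "\<alpha> * (real h / (3 * K)) \<le> \<alpha> * ln (1 + x)" using \<alpha> by (intro mult_left_mono) auto
  then show "\<alpha> * real h / (3 * K) \<le> gap_log \<alpha> \<theta> (h, k)" unfolding g by simp
  have "ln (1 + x) \<le> x" using x by (intro ln_add_one_self_le_self) auto
  then have "\<alpha> * ln (1 + x) < \<alpha> * 1" using x \<alpha> by (intro mult_strict_left_mono) auto
  then show "gap_log \<alpha> \<theta> (h, k) < \<alpha>" unfolding g by simp
  show "gap_log \<alpha> \<theta> (h, k) > 0" unfolding g using x \<alpha> by simp
  show "exp (gap_log \<alpha> \<theta> (h, k) / \<alpha>) - 1 = real h / (real k + \<theta>)"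
    unfolding g using \<alpha> x by (simp add: x_def)
qed

text \<open>Because \<open>h >= 1\<close>, the number of admissible \<open>h\<close> is at most a
  floor and no additive constant appears. The bound therefore stays proportional to \<open>S\<close>
  even when \<open>S\<close> is far below \<open>1 / K\<close>.\<close>

lemma card_gap_pairs_le:
  assumes "K \<ge> 1" "0 \<le> \<theta>" "\<theta> < 1" "\<alpha> > 0" "S \<ge> 0"
  shows "real (card {p \<in> gap_pairs K. gap_log \<alpha> \<theta> p \<le> S}) \<le> 6 * S * K\<^sup>2 / \<alpha>"
proof -
  have "{p \<in> gap_pairs K. gap_log \<alpha> \<theta> p \<le> S} \<subseteq> {1..nat \<lfloor>3 * K * S / \<alpha>\<rfloor>} \<times> {1..nat \<lfloor>2 * K\<rfloor>}"
  proof
    fix p assume p: "p \<in> {p \<in> gap_pairs K. gap_log \<alpha> \<theta> p \<le> S}"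
    then obtain h k where hk: "p = (h, k)" "(h, k) \<in> gap_pairs K" by (cases p) auto
    have "\<alpha> * real h / (3 * K) \<le> S"
      using gap_log_bounds(1)[OF hk(2) assms(1-4)] p hk by simp
    then have "real h \<le> 3 * K * S / \<alpha>" using assms by (simp add: field_simps)
    then show "p \<in> {1..nat \<lfloor>3 * K * S / \<alpha>\<rfloor>} \<times> {1..nat \<lfloor>2 * K\<rfloor>}"
      using hk assms by (auto simp: gap_pairs_def dyadic_def le_nat_floor)
  qed
  then have "card {p \<in> gap_pairs K. gap_log \<alpha> \<theta> p \<le> S} \<le> card ({1..nat \<lfloor>3 * K * S / \<alpha>\<rfloor>} \<times> {1..nat \<lfloor>2 * K\<rfloor>})"
    by (intro card_mono) auto
  also have "\<dots> = nat \<lfloor>3 * K * S / \<alpha>\<rfloor> * nat \<lfloor>2 * K\<rfloor>" by (simp add: card_cartesian_product)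
  finally have "real (card {p \<in> gap_pairs K. gap_log \<alpha> \<theta> p \<le> S}) \<le> real (nat \<lfloor>3 * K * S / \<alpha>\<rfloor>) * real (nat \<lfloor>2 * K\<rfloor>)"
    unfolding of_nat_mult[symmetric] of_nat_le_iff .
  also have "\<dots> \<le> (3 * K * S / \<alpha>) * (2 * K)"
    using assms by (intro mult_mono of_nat_floor) auto
  finally show ?thesis by (simp add: power2_eq_square mult_ac)
qed

lemma window_count_eq_card:
  "window_count \<alpha> \<theta> K \<rho> s = real (card {p \<in> gap_pairs K. \<bar>gap_log \<alpha> \<theta> p - s\<bar> \<le> \<rho>})"
proof -
  have "window_count \<alpha> \<theta> K \<rho> s = (\<Sum>p\<in>gap_pairs K. if \<bar>gap_log \<alpha> \<theta> p - s\<bar> \<le> \<rho> then 1 else 0)"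
    unfolding window_count_def by (intro sum.cong refl) (auto simp: indicator_def abs_le_iff)
  then show ?thesis by (simp add: sum.If_cases Int_def)
qed

text \<open>A pair \<open>(h, k)\<close> whose logarithm is close to \<open>s\<close> satisfies \<open>k + \<theta> \<approx> h y\<close> with
  \<open>y = 1 / (e\<^bsup>s/\<alpha>\<^esup> - 1)\<close>, so that for each \<open>h\<close> the admissible \<open>k\<close> are counted by a function of
  period \<open>1\<close> in \<open>h y\<close>.\<close>
lemma window_count_le_fejer:
  fixes \<alpha> Q K \<theta> \<rho> \<sigma> s :: real
  defines "\<eta> \<equiv> 24 * exp (4 * Q / \<alpha>) * K * \<rho> / \<sigma>"
  assumes \<alpha>: "\<alpha> > 0" and K: "K \<ge> 1" and \<theta>: "0 \<le> \<theta>" "\<theta> < 1"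
    and \<rho>: "0 < \<rho>" "2 * \<rho> \<le> \<sigma>" and \<sigma>: "\<sigma> \<le> Q" and s: "s \<in> {\<sigma>..3*\<sigma>}"
    and M_def: "M = max 1 (nat \<lfloor>1 / (8 * \<eta>)\<rfloor>)" and H_def: "H = nat \<lfloor>12 * \<sigma> * K / \<alpha>\<rfloor>"
  shows "window_count \<alpha> \<theta> K \<rho> s \<le> 64 * \<eta> * (\<Sum>h\<in>{1..H}. fejer M (\<theta> - real h * (1 / (exp (s / \<alpha>) - 1))))"
proof -
  define y where "y = 1 / (exp (s / \<alpha>) - 1)"
  have \<sigma>0: "\<sigma> > 0" using \<rho> by linarith
  have \<eta>0: "\<eta> > 0" using \<sigma>0 \<rho> K by (simp add: \<eta>_def)
  let ?S = "{p \<in> gap_pairs K. \<bar>gap_log \<alpha> \<theta> p - s\<bar> \<le> \<rho>}"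
  have "?S \<subseteq> (SIGMA h : {1..H}. {k. \<bar>real k + \<theta> - real h * y\<bar> \<le> \<eta>})"
  proof
    fix p assume p: "p \<in> ?S"
    then obtain h k where hk: "p = (h, k)" "(h, k) \<in> gap_pairs K" by (cases p) auto
    define g where "g = gap_log \<alpha> \<theta> (h, k)"
    note b = gap_log_bounds[OF hk(2) K \<theta> \<alpha>, folded g_def]
    have gs: "\<bar>g - s\<bar> \<le> \<rho>" using p hk by (simp add: g_def)
    have g: "\<sigma> / 2 \<le> g" "g \<le> 4 * \<sigma>" using gs s \<rho> by auto
    have "\<alpha> * real h / (3 * K) \<le> 4 * \<sigma>" using b(1) g(2) by linarith
    then have h: "real h \<le> 12 * \<sigma> * K / \<alpha>" using \<alpha> K by (simp add: field_simps)
    have "(real k + \<theta>) / real h = 1 / (exp (g / \<alpha>) - 1)" using b by simp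
    then have "\<bar>(real k + \<theta>) / real h - y\<bar> = \<bar>1 / (exp (g / \<alpha>) - 1) - 1 / (exp (s / \<alpha>) - 1)\<bar>"
      by (simp add: y_def)
    also have "\<dots> \<le> exp (4 * Q / \<alpha>) * \<bar>g / \<alpha> - s / \<alpha>\<bar> / ((g / \<alpha>) * (s / \<alpha>))"
      using g s \<sigma> \<sigma>0 \<alpha> by (intro inverse_exp_diff_le) (auto simp: divide_right_mono)
    also have "\<dots> = exp (4 * Q / \<alpha>) * \<alpha> * \<bar>g - s\<bar> / (g * s)"
      using \<alpha> by (simp add: field_simps flip: diff_divide_distrib)
    also have "\<dots> \<le> exp (4 * Q / \<alpha>) * \<alpha> * \<rho> / ((\<sigma> / 2) * \<sigma>)"
      using gs g s \<sigma>0 \<alpha> \<rho> by (intro frac_le mult_left_mono mult_mono) auto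
    finally have *: "\<bar>(real k + \<theta>) / real h - y\<bar> \<le> exp (4 * Q / \<alpha>) * \<alpha> * \<rho> / ((\<sigma> / 2) * \<sigma>)" .
    have "real k + \<theta> - real h * y = real h * ((real k + \<theta>) / real h - y)"
      using b(4) by (simp add: field_simps)
    then have "\<bar>real k + \<theta> - real h * y\<bar> = real h * \<bar>(real k + \<theta>) / real h - y\<bar>"
      by (simp add: abs_mult)
    \<comment> \<open>Here \<open>12\<close> comes from
      \<alpha>\<open>h / (3 K) <= 4\<close>\<sigma>, and
      \<open>g * s >= \<sigma>\<^sup>2 / 2\<close> contributes a further 2: together they are the
      \<open>24\<close> in \<eta>. As \<open>h\<close> is of order at most \<sigma>\<open>K\<close>,
      one width \<eta> serves all \<open>h\<close>.\<close>
    also have "\<dots> \<le> (12 * \<sigma> * K / \<alpha>) * (exp (4 * Q / \<alpha>) * \<alpha> * \<rho> / ((\<sigma> / 2) * \<sigma>))"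
      using h * \<sigma>0 K \<alpha> by (intro mult_mono) auto
    also have "\<dots> = \<eta>" using \<alpha> \<sigma>0 by (simp add: \<eta>_def field_simps)
    finally show "p \<in> (SIGMA h : {1..H}. {k. \<bar>real k + \<theta> - real h * y\<bar> \<le> \<eta>})"
      using h b(4) by (simp add: hk(1) H_def le_nat_floor)
  qed
  then have "card ?S \<le> card (SIGMA h : {1..H}. {k. \<bar>real k + \<theta> - real h * y\<bar> \<le> \<eta>})"
    using card_near_le_fejer(1)[OF \<eta>0 M_def] by (intro card_mono finite_SigmaI) auto
  also have "\<dots> = (\<Sum>h\<in>{1..H}. card {k. \<bar>real k + \<theta> - real h * y\<bar> \<le> \<eta>})"
    using card_near_le_fejer(1)[OF \<eta>0 M_def] by (intro card_SigmaI) auto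
  finally have "window_count \<alpha> \<theta> K \<rho> s \<le> (\<Sum>h\<in>{1..H}. real (card {k. \<bar>real k + \<theta> - real h * y\<bar> \<le> \<eta>}))"
    unfolding window_count_eq_card of_nat_sum[symmetric] of_nat_le_iff .
  also have "\<dots> \<le> (\<Sum>h\<in>{1..H}. 64 * \<eta> * fejer M (\<theta> - real h * y))"
    by (intro sum_mono card_near_le_fejer(2)[OF \<eta>0 M_def])
  finally show ?thesis by (simp add: sum_distrib_left y_def)
qed

text \<open>With \<open>G\<close> an antiderivative of \<open>g\<close>, the derivative of
  \<open>- G (y s)\<close> is at least \<open>d * g (y s)\<close>, so the substitution becomes a
  comparison of integrands and only an upper bound for \<open>y'\<close> enters.\<close>

lemma integral_comp_decreasing_le:
  fixes g y y' :: "real \<Rightarrow> real"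
  assumes g: "continuous_on {0..c} g" "\<And>x. g x \<ge> 0"
    and ab: "a \<le> b" and y: "\<And>s. s \<in> {a..b} \<Longrightarrow> y s \<in> {0..c}"
    and y': "\<And>s. s \<in> {a..b} \<Longrightarrow> (y has_real_derivative y' s) (at s within {a..b})"
    and d: "\<And>s. s \<in> {a..b} \<Longrightarrow> y' s \<le> - d"
  shows "d * integral {a..b} (\<lambda>s. g (y s)) \<le> integral {0..c} g"
proof -
  define G where "G = (\<lambda>t. integral {0..t} g)"
  have int: "g integrable_on {0..c}" by (rule integrable_continuous_real[OF g(1)])
  have G': "(G has_real_derivative g t) (at t within {0..c})" if "t \<in> {0..c}" for t
    unfolding G_def using integral_has_real_derivative[OF g(1) that] .
  have neg: "((\<lambda>s. - (g (y s) * y' s)) has_integral (- G (y b) - - G (y a))) {a..b}"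
  proof (rule fundamental_theorem_of_calculus[OF ab])
    fix s assume s: "s \<in> {a..b}"
    have "((\<lambda>s. G (y s)) has_real_derivative g (y s) * y' s) (at s within {a..b})"
      using DERIV_image_chain[of G "g (y s)" y s "{a..b}" "y' s"] y'[OF s]
        DERIV_subset[OF G'[OF y[OF s]]] y by (auto simp: o_def image_subset_iff)
    then show "((\<lambda>s. - G (y s)) has_vector_derivative - (g (y s) * y' s)) (at s within {a..b})"
      unfolding has_real_derivative_iff_has_vector_derivative[symmetric] by (rule DERIV_minus)
  qed
  have "continuous_on {a..b} (\<lambda>s. g (y s))"
  proof (rule continuous_on_compose2[OF g(1)])
    show "continuous_on {a..b} y"
      unfolding continuous_on_eq_continuous_within using DERIV_continuous[OF y'] by blast
  qed (use y in auto)
  then have pos: "((\<lambda>s. d * g (y s)) has_integral d * integral {a..b} (\<lambda>s. g (y s))) {a..b}"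
    by (intro has_integral_mult_right integrable_integral integrable_continuous_real)
  have "d * integral {a..b} (\<lambda>s. g (y s)) \<le> - G (y b) - - G (y a)"
  proof (rule has_integral_le[OF pos neg])
    fix s assume "s \<in> {a..b}"
    then show "d * g (y s) \<le> - (g (y s) * y' s)"
      using mult_right_mono[OF d g(2)[of "y s"], of s] by (simp add: mult.commute)
  qed
  also have "\<dots> \<le> G (y a)"
    using integral_nonneg[OF integrable_continuous_real[OF continuous_on_subset[OF g(1), of "{0..y b}"]]] g(2) y[of b] ab
    by (simp add: G_def)
  also have "\<dots> \<le> integral {0..c} g"
    unfolding G_def using y[of a] ab g(2)
    by (intro integral_subset_le int integrable_continuous_real continuous_on_subset[OF g(1)]) auto
  finally show ?thesis .
qed

subsection \<open>Mean square of the fluctuation\<close>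

text \<open>Half of the nonconstant part of the sum of Fejer kernels over \<open>h\<close>. The
  shift \<theta> occurs only in the phases, which makes the mean square bound uniform in it.\<close>

definition fluctuation :: "nat \<Rightarrow> nat \<Rightarrow> real \<Rightarrow> real \<Rightarrow> real" where
  "fluctuation H M \<theta> y =
     (\<Sum>p\<in>{1..H} \<times> {1..<M}. (1 - real (snd p) / real M) *
        cos (2 * pi * real (snd p) * \<theta> - 2 * pi * real (fst p * snd p) * y))"

lemma sum_fejer_eq:
  assumes "M \<ge> 1"
  shows "(\<Sum>h\<in>{1..H}. fejer M (\<theta> - real h * y)) = real H + 2 * fluctuation H M \<theta> y"
proof -
  have "(\<Sum>h\<in>{1..H}. fejer M (\<theta> - real h * y))
      = real H + 2 * (\<Sum>h\<in>{1..H}. \<Sum>m\<in>{1..<M}. (1 - real m / real M) * cos (2 * pi * real m * (\<theta> - real h * y)))"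
    by (simp add: fejer_eq[OF assms] sum.distrib sum_distrib_left)
  also have "(\<Sum>h\<in>{1..H}. \<Sum>m\<in>{1..<M}. (1 - real m / real M) * cos (2 * pi * real m * (\<theta> - real h * y)))
      = fluctuation H M \<theta> y"
    unfolding fluctuation_def sum.cartesian_product
    by (intro sum.cong refl) (auto simp: algebra_simps)
  finally show ?thesis .
qed

lemma continuous_on_fluctuation: "continuous_on A (fluctuation H M \<theta>)"
  unfolding fluctuation_def by (intro continuous_intros)

lemma integral_fluctuation_square_le:
  "integral {0..real N} (\<lambda>y. (fluctuation H M \<theta> y)\<^sup>2)
     \<le> real N * (2 * real H * real (M - 1) * (1 + ln (real (M - 1))))"
proof -
  let ?I = "{1..H} \<times> {1..<M}"
  have I: "?I = {1..H} \<times> {1..M - 1}" by auto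
  have "integral {0..real N} (\<lambda>y. (fluctuation H M \<theta> y)\<^sup>2)
      \<le> real N * real (card {(p, q). p \<in> ?I \<and> q \<in> ?I \<and> fst p * snd p = fst q * snd q})"
    unfolding fluctuation_def
    by (rule integral_cos_sum_square_le) (auto simp: divide_le_eq Suc_le_eq)
  also have "\<dots> \<le> real N * (2 * real H * real (M - 1) * (1 + ln (real (M - 1))))"
    unfolding I by (intro mult_left_mono card_equal_products_le) auto
  finally show ?thesis .
qed

text \<open>For \<open>s\<close> in the shell, \<open>y\<close> stays in an interval of length
  \<alpha>\<open>/\<close>\<sigma> and moves with speed at least of order
  \<open>\<alpha> / \<sigma>\<^sup>2\<close>. The ratio of the two is the factor \<sigma>.\<close>

lemma integral_fluctuation_comp_le:
  fixes \<alpha> Q \<sigma> :: real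
  assumes \<alpha>: "\<alpha> > 0" and \<sigma>: "0 < \<sigma>" "\<sigma> \<le> Q"
  shows "integral {\<sigma>..3*\<sigma>} (\<lambda>s. (fluctuation H M \<theta> (1 / (exp (s / \<alpha>) - 1)))\<^sup>2)
     \<le> 9 * \<sigma> * exp (4 * Q / \<alpha>) * (\<alpha> + Q) / \<alpha> * (2 * real H * real (M - 1) * (1 + ln (real (M - 1))))"
proof -
  define E where "E = exp (4 * Q / \<alpha>)"
  define B where "B = 2 * real H * real (M - 1) * (1 + ln (real (M - 1)))"
  \<comment> \<open>An integer endpoint makes the interval a union of full periods; the rounding up
    is absorbed by replacing \<alpha> with \<alpha>\<open>+ Q\<close>.\<close>
  define N where "N = nat \<lceil>\<alpha> / \<sigma>\<rceil>"
  define d where "d = \<alpha> / (9 * \<sigma>\<^sup>2 * E)"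
  let ?I = "integral {\<sigma>..3*\<sigma>} (\<lambda>s. (fluctuation H M \<theta> (1 / (exp (s / \<alpha>) - 1)))\<^sup>2)"
  have d0: "d > 0" using \<alpha> \<sigma> by (simp add: d_def E_def)
  have N: "\<alpha> / \<sigma> \<le> real N" "real N \<le> (\<alpha> + Q) / \<sigma>"
  proof -
    show "\<alpha> / \<sigma> \<le> real N" unfolding N_def by linarith
    have "0 \<le> \<alpha> / \<sigma>" using \<alpha> \<sigma> by simp
    then have "real N \<le> \<alpha> / \<sigma> + 1" unfolding N_def by linarith
    also have "\<dots> = (\<alpha> + \<sigma>) / \<sigma>" using \<sigma> by (simp add: field_simps)
    also have "\<dots> \<le> (\<alpha> + Q) / \<sigma>" using \<sigma> by (intro divide_right_mono) auto
    finally show "real N \<le> (\<alpha> + Q) / \<sigma>" .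
  qed
  have B0: "B \<ge> 0"
  proof (cases "M - 1 \<ge> 1")
    case True
    then show ?thesis by (simp add: B_def)
  next
    case False
    then have "M - 1 = 0" by linarith
    then show ?thesis by (simp add: B_def)
  qed
  have "d * ?I \<le> integral {0..real N} (\<lambda>y. (fluctuation H M \<theta> y)\<^sup>2)"
  proof (rule integral_comp_decreasing_le)
    show "continuous_on {0..real N} (\<lambda>y. (fluctuation H M \<theta> y)\<^sup>2)"
      by (intro continuous_intros continuous_on_fluctuation)
  next
    fix s assume s: "s \<in> {\<sigma>..3*\<sigma>}"
    define x where "x = s / \<alpha>"
    have x: "x > 0" "x \<le> 4 * Q / \<alpha>" using s \<sigma> \<alpha> by (auto simp: x_def divide_right_mono)
    have ex: "exp x - 1 \<ge> x" using exp_ge_add_one_self[of x] by linarith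
    then have pos: "exp x - 1 > 0" using x by linarith
    have "1 / (exp x - 1) \<le> 1 / x" using ex x pos by (intro divide_left_mono mult_pos_pos) auto
    also have "\<dots> \<le> \<alpha> / \<sigma>" using s \<alpha> \<sigma> by (simp add: x_def frac_le)
    finally show "1 / (exp (s / \<alpha>) - 1) \<in> {0..real N}" using N pos by (simp add: x_def)
    show "((\<lambda>s. 1 / (exp (s / \<alpha>) - 1)) has_real_derivative - (exp (s / \<alpha>) / (\<alpha> * (exp (s / \<alpha>) - 1)\<^sup>2)))
        (at s within {\<sigma>..3*\<sigma>})"
      using pos \<alpha> unfolding x_def
      by (auto intro!: derivative_eq_intros simp: power2_eq_square)
    \<comment> \<open>This turns the derivative into the explicit lower bound
      \<open>\<alpha> / (s\<^sup>2 * exp x)\<close>. Then \<open>s <= 3 * \<sigma>\<close> gives the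
      \<open>9\<close> in \<open>d\<close>, and \<open>x <= 4 * Q / \<alpha>\<close> gives
      \<open>E\<close>.\<close>
    have "exp x - 1 \<le> x * exp x"
      using exp_ge_add_one_self[of "- x"] mult_left_mono[of "1 - x" "exp (- x)" "exp x"]
      by (simp add: algebra_simps flip: exp_add)
    then have "(exp x - 1)\<^sup>2 \<le> (x * exp x)\<^sup>2" using pos by (intro power_mono) auto
    then have "exp x / (\<alpha> * (exp x - 1)\<^sup>2) \<ge> exp x / (\<alpha> * (x * exp x)\<^sup>2)"
      using pos \<alpha> x by (intro divide_left_mono mult_left_mono mult_pos_pos) auto
    also have "exp x / (\<alpha> * (x * exp x)\<^sup>2) = \<alpha> / (s\<^sup>2 * exp x)"
      using \<alpha> by (simp add: x_def power2_eq_square)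
    also have "\<dots> \<ge> d"
    proof -
      have "s\<^sup>2 \<le> (3 * \<sigma>)\<^sup>2" using s \<sigma> by (intro power_mono) auto
      then show ?thesis unfolding d_def E_def using s \<sigma> \<alpha> x
        by (intro divide_left_mono mult_mono mult_pos_pos) (auto simp: power2_eq_square)
    qed
    finally show "- (exp (s / \<alpha>) / (\<alpha> * (exp (s / \<alpha>) - 1)\<^sup>2)) \<le> - d" by (simp add: x_def)
  qed (use \<sigma> in auto)
  also have "\<dots> \<le> real N * B" unfolding B_def by (rule integral_fluctuation_square_le)
  also have "\<dots> \<le> (\<alpha> + Q) / \<sigma> * B" using N B0 by (intro mult_right_mono) auto
  finally have "?I \<le> (\<alpha> + Q) / \<sigma> * B / d"
    by (subst pos_le_divide_eq[OF d0]) (simp only: mult.commute)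
  also have "\<dots> = 9 * \<sigma> * E * (\<alpha> + Q) / \<alpha> * B"
    using \<alpha> \<sigma> by (simp add: d_def E_def power2_eq_square)
  finally show ?thesis by (simp add: B_def E_def)
qed

text \<open>The sizes are: \<eta> of order \<open>K \<rho> / \<sigma>\<close>, \<open>H\<close> at
  most of order \<sigma>\<open>K\<close>, and \<open>M - 1\<close> at most of order
  \<open>1 /\<close>\<eta>. The constant term \<eta>\<open>H\<close> is then of order
  \<open>K\<^sup>2 * \<rho>\<close>, the same on all shells, and the mean square of \<open>r\<close>
  is of order \<open>\<eta>\<^sup>2 * \<sigma> * H * M\<close>, that is
  \<open>\<sigma> * K\<^sup>2 * \<rho>\<close>, up to the logarithm. A free parameter \<Lambda> for
  the logarithm lets both families share one value.\<close>

lemma window_count_split: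
  fixes \<alpha> Q :: real
  assumes \<alpha>: "\<alpha> > 0" and Q: "Q > 0"
  shows "\<exists>C>0. \<forall>K \<theta> \<rho> \<sigma> \<Lambda>. K \<ge> 1 \<longrightarrow> 0 \<le> \<theta> \<longrightarrow> \<theta> < 1 \<longrightarrow> 0 < \<rho> \<longrightarrow> 2 * \<rho> \<le> \<sigma> \<longrightarrow> \<sigma> \<le> Q \<longrightarrow>
      1 \<le> \<Lambda> \<longrightarrow> 1 + ln (\<alpha> / \<rho>) \<le> \<Lambda> \<longrightarrow>
      (\<exists>r. continuous_on {\<sigma>..3*\<sigma>} r \<and> (\<forall>s\<in>{\<sigma>..3*\<sigma>}. window_count \<alpha> \<theta> K \<rho> s \<le> C * K\<^sup>2 * \<rho> + r s) \<and>
        integral {\<sigma>..3*\<sigma>} (\<lambda>s. (r s)\<^sup>2) \<le> C * \<sigma> * K\<^sup>2 * \<rho> * \<Lambda>)"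
proof -
  define E where "E = exp (4 * Q / \<alpha>)"
  \<comment> \<open>\<open>18432 = 64 * 24 * 12\<close>: from the Fejer majorant, from \<eta> and
    from \<open>H\<close>.\<close>
  define C1 where "C1 = 18432 * E / \<alpha>"
  define C2 where "C2 = 128\<^sup>2 * 9 * E * (\<alpha> + Q) / \<alpha> * (2 * 12 / \<alpha>) * (24 * E / 8)"
  have E0: "E > 0" by (simp add: E_def)
  have E1: "E * \<alpha> \<ge> Q"
    using exp_ge_add_one_self[of "4 * Q / \<alpha>"] \<alpha> Q by (simp add: E_def field_simps)
  have C0: "C1 > 0" "C2 > 0" using \<alpha> Q E0 by (auto simp: C1_def C2_def)
  show ?thesis
  proof (intro exI[of _ "C1 + C2"] conjI allI impI)
    show "C1 + C2 > 0" using C0 by simp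
    fix K \<theta> \<rho> \<sigma> \<Lambda> :: real
    assume K: "K \<ge> 1" and \<theta>: "0 \<le> \<theta>" "\<theta> < 1" and \<rho>: "0 < \<rho>" "2 * \<rho> \<le> \<sigma>" and \<sigma>: "\<sigma> \<le> Q"
      and \<Lambda>: "1 \<le> \<Lambda>" "1 + ln (\<alpha> / \<rho>) \<le> \<Lambda>"
    have \<sigma>0: "\<sigma> > 0" using \<rho> by linarith
    define \<eta> where "\<eta> = 24 * E * K * \<rho> / \<sigma>"
    define M where "M = max 1 (nat \<lfloor>1 / (8 * \<eta>)\<rfloor>)"
    define H where "H = nat \<lfloor>12 * \<sigma> * K / \<alpha>\<rfloor>"
    define y where "y = (\<lambda>s. 1 / (exp (s / \<alpha>) - 1))"
    define r where "r = (\<lambda>s. 128 * \<eta> * fluctuation H M \<theta> (y s))"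
    have \<eta>0: "\<eta> > 0" using E0 K \<rho> \<sigma>0 by (simp add: \<eta>_def)
    have H: "real H \<le> 12 * \<sigma> * K / \<alpha>" unfolding H_def using \<sigma>0 K \<alpha> by (intro of_nat_floor) auto
    have M1: "real (M - 1) \<le> 1 / (8 * \<eta>)"
      unfolding M_def using \<eta>0 by (auto simp: max_def) linarith
    have lnM: "1 + ln (real (M - 1)) \<le> \<Lambda>"
    proof (cases "M - 1 = 0")
      case False
      \<comment> \<open>Discarding \<open>K >= 1\<close> and absorbing \<sigma>\<open><= Q\<close>
        into \<open>E * \<alpha>\<close> leaves a bound for \<open>M - 1\<close> free of
        \<open>K\<close> and \<sigma>, so the logarithm depends on \<rho> only.\<close>
      have "1 / (8 * \<eta>) = \<sigma> / (192 * E * K * \<rho>)" using \<sigma>0 by (simp add: \<eta>_def)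
      also have "\<dots> \<le> (E * \<alpha>) / (E * \<rho>)"
        using \<sigma> E1 E0 K \<rho> mult_mono[of 1 K "E * \<rho>" "192 * E * \<rho>"] \<alpha>
        by (intro frac_le) (auto simp: algebra_simps)
      also have "\<dots> = \<alpha> / \<rho>" using E0 by simp
      finally have "real (M - 1) \<le> \<alpha> / \<rho>" using M1 by linarith
      then have "ln (real (M - 1)) \<le> ln (\<alpha> / \<rho>)" using False by (subst ln_le_cancel_iff) (auto simp: \<alpha> \<rho>)
      then show ?thesis using \<Lambda> by linarith
    qed (use \<Lambda> in simp)
    have y_cont: "continuous_on {\<sigma>..3*\<sigma>} y"
    proof -
      have "exp (s / \<alpha>) - 1 \<noteq> 0" if "s \<in> {\<sigma>..3*\<sigma>}" for s
        using that \<sigma>0 \<alpha> by auto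
      then show ?thesis unfolding y_def by (intro continuous_intros) (use \<alpha> in auto)
    qed
    show "\<exists>r. continuous_on {\<sigma>..3*\<sigma>} r \<and>
        (\<forall>s\<in>{\<sigma>..3*\<sigma>}. window_count \<alpha> \<theta> K \<rho> s \<le> (C1 + C2) * K\<^sup>2 * \<rho> + r s) \<and>
        integral {\<sigma>..3*\<sigma>} (\<lambda>s. (r s)\<^sup>2) \<le> (C1 + C2) * \<sigma> * K\<^sup>2 * \<rho> * \<Lambda>"
    proof (intro exI[of _ r] conjI ballI)
      show "continuous_on {\<sigma>..3*\<sigma>} r"
        unfolding r_def
        by (intro continuous_intros continuous_on_compose2[OF continuous_on_fluctuation[of UNIV] y_cont]) auto
    next
      fix s assume s: "s \<in> {\<sigma>..3*\<sigma>}"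
      have "window_count \<alpha> \<theta> K \<rho> s \<le> 64 * \<eta> * (\<Sum>h\<in>{1..H}. fejer M (\<theta> - real h * y s))"
        unfolding y_def using window_count_le_fejer[OF \<alpha> K \<theta> \<rho> \<sigma> s, folded E_def, folded \<eta>_def, OF M_def H_def] .
      also have "\<dots> = 64 * \<eta> * real H + r s"
        by (subst sum_fejer_eq) (auto simp: M_def r_def algebra_simps)
      also have "64 * \<eta> * real H \<le> 64 * \<eta> * (12 * \<sigma> * K / \<alpha>)"
        using H \<eta>0 by (intro mult_left_mono) auto
      also have "\<dots> = C1 * K\<^sup>2 * \<rho>" using \<sigma>0 by (simp add: \<eta>_def C1_def power2_eq_square)
      also have "\<dots> \<le> (C1 + C2) * K\<^sup>2 * \<rho>" using C0 K \<rho> by (intro mult_right_mono) auto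
      finally show "window_count \<alpha> \<theta> K \<rho> s \<le> (C1 + C2) * K\<^sup>2 * \<rho> + r s" by simp
    next
      have "integral {\<sigma>..3*\<sigma>} (\<lambda>s. (r s)\<^sup>2) = (128 * \<eta>)\<^sup>2 * integral {\<sigma>..3*\<sigma>} (\<lambda>s. (fluctuation H M \<theta> (y s))\<^sup>2)"
        by (simp add: r_def power_mult_distrib)
      also have "\<dots> \<le> (128 * \<eta>)\<^sup>2 * (9 * \<sigma> * E * (\<alpha> + Q) / \<alpha> * (2 * real H * real (M - 1) * (1 + ln (real (M - 1)))))"
        unfolding y_def E_def
        using integral_fluctuation_comp_le[OF \<alpha> \<sigma>0 \<sigma>] by (intro mult_left_mono) auto
      also have "\<dots> = 128\<^sup>2 * (9 * \<sigma> * E * (\<alpha> + Q) / \<alpha>) * \<eta> * (2 * real H) * ((\<eta> * real (M - 1)) * (1 + ln (real (M - 1))))"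
        by (simp add: power2_eq_square)
      also have "\<dots> \<le> 128\<^sup>2 * (9 * \<sigma> * E * (\<alpha> + Q) / \<alpha>) * \<eta> * (2 * (12 * \<sigma> * K / \<alpha>)) * (1 / 8 * \<Lambda>)"
      proof (rule mult_mono)
        show "128\<^sup>2 * (9 * \<sigma> * E * (\<alpha> + Q) / \<alpha>) * \<eta> * (2 * real H) \<le> 128\<^sup>2 * (9 * \<sigma> * E * (\<alpha> + Q) / \<alpha>) * \<eta> * (2 * (12 * \<sigma> * K / \<alpha>))"
          using H \<sigma>0 E0 \<alpha> Q \<eta>0 by (intro mult_left_mono) auto
        have "\<eta> * real (M - 1) \<le> \<eta> * (1 / (8 * \<eta>))" using M1 \<eta>0 by (intro mult_left_mono) auto
        then have "\<eta> * real (M - 1) \<le> 1 / 8" using \<eta>0 by simp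
        moreover have "0 \<le> \<eta> * real (M - 1)" using \<eta>0 by simp
        ultimately have "\<eta> * real (M - 1) * (1 + ln (real (M - 1))) \<le> \<eta> * real (M - 1) * \<Lambda>"
            "\<eta> * real (M - 1) * \<Lambda> \<le> 1 / 8 * \<Lambda>"
          using lnM \<Lambda> by (intro mult_left_mono mult_right_mono; simp)+
        then show "\<eta> * real (M - 1) * (1 + ln (real (M - 1))) \<le> 1 / 8 * \<Lambda>" by linarith
        show "0 \<le> 128\<^sup>2 * (9 * \<sigma> * E * (\<alpha> + Q) / \<alpha>) * \<eta> * (2 * (12 * \<sigma> * K / \<alpha>))"
          using \<sigma>0 E0 \<alpha> Q \<eta>0 K by auto
        show "0 \<le> \<eta> * real (M - 1) * (1 + ln (real (M - 1)))"
        proof (cases "M - 1 = 0")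
          case False
          then have "ln (real (M - 1)) \<ge> 0" by simp
          then show ?thesis using \<eta>0 by simp
        qed simp
      qed
      also have "\<dots> = C2 * \<sigma> * K\<^sup>2 * \<rho> * \<Lambda>"
        using \<sigma>0 by (simp add: \<eta>_def C2_def power2_eq_square)
      also have "\<dots> \<le> (C1 + C2) * \<sigma> * K\<^sup>2 * \<rho> * \<Lambda>"
        using C0 \<sigma>0 K \<rho> \<Lambda> by (intro mult_right_mono) auto
      finally show "integral {\<sigma>..3*\<sigma>} (\<lambda>s. (r s)\<^sup>2) \<le> (C1 + C2) * \<sigma> * K\<^sup>2 * \<rho> * \<Lambda>" .
    qed
  qed
qed

subsection \<open>Coincidences between two families\<close>

lemma has_integral_indicator_interval:
  fixes a b c d :: real
  shows "((indicator {a..b} :: real \<Rightarrow> real) has_integral max 0 (min b d - max a c)) {c..d}"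
proof -
  have "((\<lambda>x. 1 :: real) has_integral max 0 (min b d - max a c)) {max a c..min b d}"
    using has_integral_const_real[of "1::real" "max a c" "min b d"] by (cases "max a c \<le> min b d") auto
  also have "{max a c..min b d} = {a..b} \<inter> {c..d}" by auto
  finally have "((\<lambda>x. if x \<in> {a..b} then 1 else 0 :: real) has_integral max 0 (min b d - max a c)) {c..d}"
    by (subst has_integral_restrict_Int)
  also have "(\<lambda>x. if x \<in> {a..b} then 1 else 0) = (indicator {a..b} :: real \<Rightarrow> real)"
    by (auto simp: indicator_def fun_eq_iff)
  finally show ?thesis .
qed

lemma window_count_integrable: "window_count \<alpha> \<theta> K \<rho> integrable_on {c..d}"
  unfolding window_count_def
  by (intro integrable_sum finite_gap_pairs has_integral_integrable[OF has_integral_indicator_interval])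

lemma window_count_nonneg: "window_count \<alpha> \<theta> K \<rho> s \<ge> 0"
  unfolding window_count_def by (intro sum_nonneg) auto

text \<open>Since \<rho>\<open><=\<close>\<sigma>, only gaps up to \<open>4 * \<sigma>\<close> can
  meet the shell, each with length at most \<open>2 * \<rho>\<close>. This first moment controls the
  terms in which a mean multiplies a count.\<close>

lemma integral_window_count_le:
  assumes K: "K \<ge> 1" and \<theta>: "0 \<le> \<theta>" "\<theta> < 1" and \<alpha>: "\<alpha> > 0" and \<rho>: "0 < \<rho>" "\<rho> \<le> \<sigma>"
  shows "integral {\<sigma>..3*\<sigma>} (window_count \<alpha> \<theta> K \<rho>) \<le> 48 / \<alpha> * \<sigma> * K\<^sup>2 * \<rho>"
proof -
  let ?P = "{p \<in> gap_pairs K. gap_log \<alpha> \<theta> p \<le> 4 * \<sigma>}"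
  let ?i = "\<lambda>p. max 0 (min (gap_log \<alpha> \<theta> p + \<rho>) (3 * \<sigma>) - max (gap_log \<alpha> \<theta> p - \<rho>) \<sigma>)"
  have "(window_count \<alpha> \<theta> K \<rho> has_integral (\<Sum>p\<in>gap_pairs K. ?i p)) {\<sigma>..3*\<sigma>}"
    unfolding window_count_def
    by (intro has_integral_sum finite_gap_pairs has_integral_indicator_interval)
  then have "integral {\<sigma>..3*\<sigma>} (window_count \<alpha> \<theta> K \<rho>) = (\<Sum>p\<in>gap_pairs K. ?i p)"
    by (rule integral_unique)
  also have "\<dots> = (\<Sum>p\<in>?P. ?i p)"
    by (rule sum.mono_neutral_right) (use \<rho> in \<open>auto simp: max_def min_def\<close>)
  also have "\<dots> \<le> (\<Sum>p\<in>?P. 2 * \<rho>)"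
    by (intro sum_mono) (use \<rho> in \<open>auto simp: max_def min_def\<close>)
  also have "\<dots> = real (card ?P) * (2 * \<rho>)" by simp
  also have "\<dots> \<le> 6 * (4 * \<sigma>) * K\<^sup>2 / \<alpha> * (2 * \<rho>)"
    using \<rho> by (intro mult_right_mono card_gap_pairs_le K \<theta> \<alpha>) auto
  finally show ?thesis by (simp add: mult_ac)
qed

definition close_gaps :: "real \<Rightarrow> real \<Rightarrow> real \<Rightarrow> real \<Rightarrow> real \<Rightarrow> real \<Rightarrow> real \<Rightarrow> ((nat \<times> nat) \<times> (nat \<times> nat)) set" where
  "close_gaps \<alpha> \<theta> K \<beta> \<xi> L T =
     {(p, q). p \<in> gap_pairs K \<and> q \<in> gap_pairs L \<and> \<bar>gap_log \<alpha> \<theta> p - gap_log \<beta> \<xi> q\<bar> \<le> 1 / T}"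

lemma finite_close_gaps [simp]: "finite (close_gaps \<alpha> \<theta> K \<beta> \<xi> L T)"
  by (rule finite_subset[of _ "gap_pairs K \<times> gap_pairs L"]) (auto simp: close_gaps_def)

text \<open>If \<open>g\<close> is the first value of a counted pair, the interval from
  \<open>g\<close> to \<open>g + 1 / T\<close> lies in both windows of half-width
  \<open>2 / T\<close>, and it ends before \<open>3 * \<sigma>\<close> because
  \<open>g < 2 * \<sigma>\<close>. Each pair thus contributes at least \<open>1 / T\<close> to the
  integral.\<close>

lemma card_close_gaps_shell_le_integral:
  assumes T: "T > 0" and \<sigma>: "1 / T \<le> \<sigma>"
  shows "real (card {z \<in> close_gaps \<alpha> \<theta> K \<beta> \<xi> L T. \<sigma> \<le> gap_log \<alpha> \<theta> (fst z) \<and> gap_log \<alpha> \<theta> (fst z) < 2 * \<sigma>}) / T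
    \<le> integral {\<sigma>..3*\<sigma>} (\<lambda>s. window_count \<alpha> \<theta> K (2 / T) s * window_count \<beta> \<xi> L (2 / T) s)"
    and "(\<lambda>s. window_count \<alpha> \<theta> K (2 / T) s * window_count \<beta> \<xi> L (2 / T) s) integrable_on {\<sigma>..3*\<sigma>}"
proof -
  let ?Z = "{z \<in> close_gaps \<alpha> \<theta> K \<beta> \<xi> L T. \<sigma> \<le> gap_log \<alpha> \<theta> (fst z) \<and> gap_log \<alpha> \<theta> (fst z) < 2 * \<sigma>}"
  let ?lo = "\<lambda>z. max (gap_log \<alpha> \<theta> (fst z) - 2 / T) (gap_log \<beta> \<xi> (snd z) - 2 / T)"
  let ?hi = "\<lambda>z. min (gap_log \<alpha> \<theta> (fst z) + 2 / T) (gap_log \<beta> \<xi> (snd z) + 2 / T)"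
  let ?i = "\<lambda>z. max 0 (min (?hi z) (3 * \<sigma>) - max (?lo z) \<sigma>)"
  have eq: "window_count \<alpha> \<theta> K (2 / T) s * window_count \<beta> \<xi> L (2 / T) s
      = (\<Sum>z\<in>gap_pairs K \<times> gap_pairs L. indicator {?lo z..?hi z} s)" for s
    unfolding window_count_def sum_product sum.cartesian_product
    by (intro sum.cong refl) (auto simp: indicator_def)
  have int: "((\<lambda>s. window_count \<alpha> \<theta> K (2 / T) s * window_count \<beta> \<xi> L (2 / T) s) has_integral
      (\<Sum>z\<in>gap_pairs K \<times> gap_pairs L. ?i z)) {\<sigma>..3*\<sigma>}"
    unfolding eq by (intro has_integral_sum finite_cartesian_product finite_gap_pairs has_integral_indicator_interval)
  then show "(\<lambda>s. window_count \<alpha> \<theta> K (2 / T) s * window_count \<beta> \<xi> L (2 / T) s) integrable_on {\<sigma>..3*\<sigma>}"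
    by (rule has_integral_integrable)
  have "real (card ?Z) / T = (\<Sum>z\<in>?Z. 1 / T)" by simp
  also have "\<dots> \<le> (\<Sum>z\<in>?Z. ?i z)"
  proof (rule sum_mono)
    fix z assume "z \<in> ?Z"
    then have "\<bar>gap_log \<alpha> \<theta> (fst z) - gap_log \<beta> \<xi> (snd z)\<bar> \<le> 1 / T"
      "\<sigma> \<le> gap_log \<alpha> \<theta> (fst z)" "gap_log \<alpha> \<theta> (fst z) < 2 * \<sigma>" by (auto simp: close_gaps_def)
    moreover have "0 < 1 / T" "2 / T = 1 / T + 1 / T" using T by auto
    ultimately show "1 / T \<le> ?i z" using \<sigma> by (auto simp: max_def min_def)
  qed
  also have "\<dots> \<le> (\<Sum>z\<in>gap_pairs K \<times> gap_pairs L. ?i z)"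
    by (intro sum_mono2) (auto simp: close_gaps_def)
  finally show "real (card ?Z) / T \<le> integral {\<sigma>..3*\<sigma>} (\<lambda>s. window_count \<alpha> \<theta> K (2 / T) s * window_count \<beta> \<xi> L (2 / T) s)"
    using integral_unique[OF int] by simp
qed

text \<open>If one count is at most twice its mean, the product is at most twice that mean times the
  other count. Otherwise both counts are at most twice their fluctuations, and the weighted
  inequality between geometric and arithmetic means applies. No mean ever multiplies a fluctuation,
  whose sign is unknown.\<close>

lemma mult_le_of_split:
  fixes a b \<mu> \<nu> r q w :: real
  assumes "0 \<le> a" "0 \<le> b" "a \<le> \<mu> + r" "b \<le> \<nu> + q" "0 \<le> \<mu>" "0 \<le> \<nu>" "w > 0"
  shows "a * b \<le> 2 * \<mu> * b + 2 * \<nu> * a + (2 * w * r\<^sup>2 + 2 / w * q\<^sup>2)"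
proof -
  have sq: "2 * w * r\<^sup>2 + 2 / w * q\<^sup>2 \<ge> 4 * (r * q)"
  proof -
    have "0 \<le> 2 * w * (r - q / w)\<^sup>2" using assms by simp
    also have "\<dots> = 2 * w * r\<^sup>2 + 2 / w * q\<^sup>2 - 4 * (r * q)"
      using assms by (simp add: power2_eq_square field_simps)
    finally show ?thesis by simp
  qed
  have nn: "2 * w * r\<^sup>2 + 2 / w * q\<^sup>2 \<ge> 0" "2 * \<mu> * b \<ge> 0" "2 * \<nu> * a \<ge> 0" using assms by auto
  consider "a \<le> 2 * \<mu>" | "b \<le> 2 * \<nu>" | "a > 2 * \<mu>" "b > 2 * \<nu>" by linarith
  then show ?thesis
  proof cases
    case 1
    then show ?thesis using mult_right_mono[OF 1 assms(2)] nn by linarith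
  next
    case 2
    then have "a * b \<le> 2 * \<nu> * a" using mult_right_mono[OF 2 assms(1)] by (simp only: mult.commute)
    then show ?thesis using nn by linarith
  next
    case 3
    then have "a \<le> 2 * r" "b \<le> 2 * q" using assms by linarith+
    then have "a * b \<le> (2 * r) * (2 * q)" using assms by (intro mult_mono) linarith+
    then show ?thesis using sq nn by linarith
  qed
qed

lemma card_close_gaps_shell_le:
  fixes \<alpha> \<beta> Q :: real
  assumes \<alpha>: "\<alpha> > 0" and \<beta>: "\<beta> > 0" and Q: "Q > 0"
  shows "\<exists>C>0. \<forall>K \<theta> L \<xi> T \<sigma> \<Lambda>. K \<ge> 1 \<longrightarrow> 0 \<le> \<theta> \<longrightarrow> \<theta> < 1 \<longrightarrow> L \<ge> 1 \<longrightarrow> 0 \<le> \<xi> \<longrightarrow> \<xi> < 1 \<longrightarrow>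
      T > 0 \<longrightarrow> 4 / T \<le> \<sigma> \<longrightarrow> \<sigma> \<le> Q \<longrightarrow>
      1 \<le> \<Lambda> \<longrightarrow> 1 + ln (\<alpha> * T / 2) \<le> \<Lambda> \<longrightarrow> 1 + ln (\<beta> * T / 2) \<le> \<Lambda> \<longrightarrow>
      real (card {z \<in> close_gaps \<alpha> \<theta> K \<beta> \<xi> L T. \<sigma> \<le> gap_log \<alpha> \<theta> (fst z) \<and> gap_log \<alpha> \<theta> (fst z) < 2 * \<sigma>})
        \<le> C * \<sigma> * (K\<^sup>2 * L\<^sup>2 / T + K * L * \<Lambda>)"
proof -
  obtain C1 where C1: "C1 > 0" and split1: "\<And>K \<theta> \<rho> \<sigma> \<Lambda>. K \<ge> 1 \<Longrightarrow> 0 \<le> \<theta> \<Longrightarrow> \<theta> < 1 \<Longrightarrow> 0 < \<rho> \<Longrightarrow> 2 * \<rho> \<le> \<sigma> \<Longrightarrow> \<sigma> \<le> Q \<Longrightarrow>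
      1 \<le> \<Lambda> \<Longrightarrow> 1 + ln (\<alpha> / \<rho>) \<le> \<Lambda> \<Longrightarrow>
      (\<exists>r. continuous_on {\<sigma>..3*\<sigma>} r \<and> (\<forall>s\<in>{\<sigma>..3*\<sigma>}. window_count \<alpha> \<theta> K \<rho> s \<le> C1 * K\<^sup>2 * \<rho> + r s) \<and>
        integral {\<sigma>..3*\<sigma>} (\<lambda>s. (r s)\<^sup>2) \<le> C1 * \<sigma> * K\<^sup>2 * \<rho> * \<Lambda>)"
    using window_count_split[OF \<alpha> Q] by blast
  obtain C2 where C2: "C2 > 0" and split2: "\<And>K \<theta> \<rho> \<sigma> \<Lambda>. K \<ge> 1 \<Longrightarrow> 0 \<le> \<theta> \<Longrightarrow> \<theta> < 1 \<Longrightarrow> 0 < \<rho> \<Longrightarrow> 2 * \<rho> \<le> \<sigma> \<Longrightarrow> \<sigma> \<le> Q \<Longrightarrow>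
      1 \<le> \<Lambda> \<Longrightarrow> 1 + ln (\<beta> / \<rho>) \<le> \<Lambda> \<Longrightarrow>
      (\<exists>r. continuous_on {\<sigma>..3*\<sigma>} r \<and> (\<forall>s\<in>{\<sigma>..3*\<sigma>}. window_count \<beta> \<theta> K \<rho> s \<le> C2 * K\<^sup>2 * \<rho> + r s) \<and>
        integral {\<sigma>..3*\<sigma>} (\<lambda>s. (r s)\<^sup>2) \<le> C2 * \<sigma> * K\<^sup>2 * \<rho> * \<Lambda>)"
    using window_count_split[OF \<beta> Q] by blast
  define D1 where "D1 = 2 * C1 * (48 / \<beta>) * 4 + 2 * C2 * (48 / \<alpha>) * 4"
  define D2 where "D2 = 4 * C1 + 4 * C2"
  have D: "D1 > 0" "D2 > 0" using C1 C2 \<alpha> \<beta> by (auto simp: D1_def D2_def intro!: add_pos_pos)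
  show ?thesis
  proof (intro exI[of _ "D1 + D2"] conjI allI impI)
    show "D1 + D2 > 0" using D by simp
    fix K \<theta> L \<xi> T \<sigma> \<Lambda> :: real
    assume K: "K \<ge> 1" and \<theta>: "0 \<le> \<theta>" "\<theta> < 1" and L: "L \<ge> 1" and \<xi>: "0 \<le> \<xi>" "\<xi> < 1"
      and T: "T > 0" and \<sigma>: "4 / T \<le> \<sigma>" "\<sigma> \<le> Q"
      and \<Lambda>: "1 \<le> \<Lambda>" "1 + ln (\<alpha> * T / 2) \<le> \<Lambda>" "1 + ln (\<beta> * T / 2) \<le> \<Lambda>"
    define \<rho> where "\<rho> = 2 / T"
    have \<rho>: "0 < \<rho>" "2 * \<rho> \<le> \<sigma>" "\<rho> \<le> \<sigma>" using T \<sigma> by (auto simp: \<rho>_def field_simps)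
    have \<sigma>0: "\<sigma> > 0" using \<rho> by linarith
    have \<Lambda>': "1 + ln (\<alpha> / \<rho>) \<le> \<Lambda>" "1 + ln (\<beta> / \<rho>) \<le> \<Lambda>" using \<Lambda> by (simp_all add: \<rho>_def)
    let ?I = "{\<sigma>..3*\<sigma>}"
    let ?a = "window_count \<alpha> \<theta> K \<rho>" and ?b = "window_count \<beta> \<xi> L \<rho>"
    obtain r where r: "continuous_on ?I r" "\<And>s. s \<in> ?I \<Longrightarrow> ?a s \<le> C1 * K\<^sup>2 * \<rho> + r s"
      "integral ?I (\<lambda>s. (r s)\<^sup>2) \<le> C1 * \<sigma> * K\<^sup>2 * \<rho> * \<Lambda>"
      using split1[OF K \<theta> \<rho>(1,2) \<sigma>(2) \<Lambda>(1) \<Lambda>'(1)] by blast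
    obtain q where q: "continuous_on ?I q" "\<And>s. s \<in> ?I \<Longrightarrow> ?b s \<le> C2 * L\<^sup>2 * \<rho> + q s"
      "integral ?I (\<lambda>s. (q s)\<^sup>2) \<le> C2 * \<sigma> * L\<^sup>2 * \<rho> * \<Lambda>"
      using split2[OF L \<xi> \<rho>(1,2) \<sigma>(2) \<Lambda>(1) \<Lambda>'(2)] by blast
    have ir: "(\<lambda>s. (r s)\<^sup>2) integrable_on ?I" "(\<lambda>s. (q s)\<^sup>2) integrable_on ?I"
      by (intro integrable_continuous_real continuous_intros r q)+
    let ?m = "2 * (C1 * K\<^sup>2 * \<rho>)" and ?n = "2 * (C2 * L\<^sup>2 * \<rho>)"
    \<comment> \<open>The mean squares of \<open>r\<close> and \<open>q\<close> are of orders
      \<open>K\<^sup>2\<close> and \<open>L\<^sup>2\<close>; this weight balances them at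
      \<open>K * L\<close>, as Cauchy-Schwarz would.\<close>
    let ?w = "L / K"
    have w: "?w > 0" using K L by simp
    have hi: "((\<lambda>s. ?m * ?b s + ?n * ?a s + (2 * ?w * (r s)\<^sup>2 + 2 / ?w * (q s)\<^sup>2)) has_integral
        (?m * integral ?I ?b + ?n * integral ?I ?a
          + (2 * ?w * integral ?I (\<lambda>s. (r s)\<^sup>2) + 2 / ?w * integral ?I (\<lambda>s. (q s)\<^sup>2)))) ?I"
      by (intro has_integral_add has_integral_mult_right integrable_integral window_count_integrable ir)
    have "1 / T \<le> \<sigma>" using \<sigma>(1) T by (simp add: field_simps)
    note Z = card_close_gaps_shell_le_integral[OF T this, of \<alpha> \<theta> K \<beta> \<xi> L, folded \<rho>_def]
    let ?Z = "{z \<in> close_gaps \<alpha> \<theta> K \<beta> \<xi> L T. \<sigma> \<le> gap_log \<alpha> \<theta> (fst z) \<and> gap_log \<alpha> \<theta> (fst z) < 2 * \<sigma>}"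
    have "real (card ?Z) / T \<le> integral ?I (\<lambda>s. ?a s * ?b s)" by (rule Z(1))
    also have "\<dots> \<le> ?m * integral ?I ?b + ?n * integral ?I ?a
          + (2 * ?w * integral ?I (\<lambda>s. (r s)\<^sup>2) + 2 / ?w * integral ?I (\<lambda>s. (q s)\<^sup>2))"
    proof (rule has_integral_le[OF integrable_integral[OF Z(2)] hi])
      fix s assume s: "s \<in> ?I"
      show "?a s * ?b s \<le> ?m * ?b s + ?n * ?a s + (2 * ?w * (r s)\<^sup>2 + 2 / ?w * (q s)\<^sup>2)"
        using mult_le_of_split[OF window_count_nonneg window_count_nonneg r(2)[OF s] q(2)[OF s] _ _ w]
          C1 C2 \<rho>(1) by simp
    qed
    also have "\<dots> \<le> ?m * (48 / \<beta> * \<sigma> * L\<^sup>2 * \<rho>) + ?n * (48 / \<alpha> * \<sigma> * K\<^sup>2 * \<rho>)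
          + (2 * ?w * (C1 * \<sigma> * K\<^sup>2 * \<rho> * \<Lambda>) + 2 / ?w * (C2 * \<sigma> * L\<^sup>2 * \<rho> * \<Lambda>))"
      using C1 C2 \<rho> K L
      by (intro add_mono mult_left_mono integral_window_count_le K L \<theta> \<xi> \<alpha> \<beta> r q) auto
    also have "\<dots> = (D1 * \<sigma> * (K\<^sup>2 * L\<^sup>2 / T) + D2 * \<sigma> * (K * L * \<Lambda>)) / T"
    proof -
      have "?m * (48 / \<beta> * \<sigma> * L\<^sup>2 * \<rho>) = 2 * C1 * (48 / \<beta>) * 4 * (\<sigma> * (K\<^sup>2 * L\<^sup>2 / T) / T)"
        "?n * (48 / \<alpha> * \<sigma> * K\<^sup>2 * \<rho>) = 2 * C2 * (48 / \<alpha>) * 4 * (\<sigma> * (K\<^sup>2 * L\<^sup>2 / T) / T)"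
        by (simp_all add: \<rho>_def mult_ac)
      moreover have "2 * ?w * (C1 * \<sigma> * K\<^sup>2 * \<rho> * \<Lambda>) = 4 * C1 * (\<sigma> * (K * L * \<Lambda>) / T)"
        "2 / ?w * (C2 * \<sigma> * L\<^sup>2 * \<rho> * \<Lambda>) = 4 * C2 * (\<sigma> * (K * L * \<Lambda>) / T)"
        using K L by (simp_all add: \<rho>_def power2_eq_square)
      ultimately show ?thesis
        by (simp only: D1_def D2_def add_divide_distrib distrib_right mult.assoc times_divide_eq_right)
    qed
    finally have "real (card ?Z) \<le> D1 * \<sigma> * (K\<^sup>2 * L\<^sup>2 / T) + D2 * \<sigma> * (K * L * \<Lambda>)"
      using T by (simp add: divide_le_cancel)
    also have "\<dots> \<le> (D1 + D2) * \<sigma> * (K\<^sup>2 * L\<^sup>2 / T) + (D1 + D2) * \<sigma> * (K * L * \<Lambda>)"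
      using D \<sigma>0 K L T \<Lambda> by (intro add_mono mult_right_mono) auto
    finally show "real (card ?Z) \<le> (D1 + D2) * \<sigma> * (K\<^sup>2 * L\<^sup>2 / T + K * L * \<Lambda>)"
      by (simp add: distrib_left)
  qed
qed

text \<open>All gaps lie below \<alpha>, which is halved until the shell reaches order
  \<open>1 / T\<close>; the shell bounds are proportional to \<sigma> and add up to a multiple of
  \<alpha>. Below \<open>8 / T\<close> both gaps are small, and the product of the two separate
  counts is already admissible.\<close>

lemma card_close_gaps_le:
  fixes \<alpha> \<beta> :: real
  assumes \<alpha>: "\<alpha> > 0" and \<beta>: "\<beta> > 0"
  shows "\<exists>C>0. \<forall>K \<theta> L \<xi> T \<Lambda>. K \<ge> 1 \<longrightarrow> 0 \<le> \<theta> \<longrightarrow> \<theta> < 1 \<longrightarrow> L \<ge> 1 \<longrightarrow> 0 \<le> \<xi> \<longrightarrow> \<xi> < 1 \<longrightarrow>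
      T \<ge> 1 \<longrightarrow> 1 \<le> \<Lambda> \<longrightarrow> 1 + ln (\<alpha> * T / 2) \<le> \<Lambda> \<longrightarrow> 1 + ln (\<beta> * T / 2) \<le> \<Lambda> \<longrightarrow>
      real (card (close_gaps \<alpha> \<theta> K \<beta> \<xi> L T)) \<le> C * (K\<^sup>2 * L\<^sup>2 / T + K * L * \<Lambda>)"
proof -
  obtain C where C: "C > 0" and shell: "\<And>K \<theta> L \<xi> T \<sigma> \<Lambda>. K \<ge> 1 \<Longrightarrow> 0 \<le> \<theta> \<Longrightarrow> \<theta> < 1 \<Longrightarrow> L \<ge> 1 \<Longrightarrow> 0 \<le> \<xi> \<Longrightarrow> \<xi> < 1 \<Longrightarrow>
      T > 0 \<Longrightarrow> 4 / T \<le> \<sigma> \<Longrightarrow> \<sigma> \<le> \<alpha> \<Longrightarrow>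
      1 \<le> \<Lambda> \<Longrightarrow> 1 + ln (\<alpha> * T / 2) \<le> \<Lambda> \<Longrightarrow> 1 + ln (\<beta> * T / 2) \<le> \<Lambda> \<Longrightarrow>
      real (card {z \<in> close_gaps \<alpha> \<theta> K \<beta> \<xi> L T. \<sigma> \<le> gap_log \<alpha> \<theta> (fst z) \<and> gap_log \<alpha> \<theta> (fst z) < 2 * \<sigma>})
        \<le> C * \<sigma> * (K\<^sup>2 * L\<^sup>2 / T + K * L * \<Lambda>)"
    using card_close_gaps_shell_le[OF \<alpha> \<beta> \<alpha>] by blast
  define D where "D = 48 / \<alpha> * (54 / \<beta>)"
  have D: "D > 0" using \<alpha> \<beta> by (simp add: D_def)
  show ?thesis
  proof (intro exI[of _ "D + C * \<alpha>"] conjI allI impI)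
    show "D + C * \<alpha> > 0" using C D \<alpha> by (intro add_pos_pos) auto
    fix K \<theta> L \<xi> T \<Lambda> :: real
    assume K: "K \<ge> 1" and \<theta>: "0 \<le> \<theta>" "\<theta> < 1" and L: "L \<ge> 1" and \<xi>: "0 \<le> \<xi>" "\<xi> < 1"
      and T: "T \<ge> 1" and \<Lambda>: "1 \<le> \<Lambda>" "1 + ln (\<alpha> * T / 2) \<le> \<Lambda>" "1 + ln (\<beta> * T / 2) \<le> \<Lambda>"
    have T0: "T > 0" using T by simp
    define X where "X = K\<^sup>2 * L\<^sup>2 / T + K * L * \<Lambda>"
    define Z where "Z = (\<lambda>S. {z \<in> close_gaps \<alpha> \<theta> K \<beta> \<xi> L T. gap_log \<alpha> \<theta> (fst z) < S})"
    have finZ: "finite (Z S)" for S by (simp add: Z_def)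
    have X0: "X \<ge> 0" using K L T \<Lambda> by (simp add: X_def)
    have all: "close_gaps \<alpha> \<theta> K \<beta> \<xi> L T = Z \<alpha>"
      using gap_log_bounds(2)[OF _ K \<theta> \<alpha>] by (auto simp: Z_def close_gaps_def)
    have near: "real (card (Z S)) \<le> D * X" if "S \<le> 8 / T" for S
    proof -
      let ?P = "{p \<in> gap_pairs K. gap_log \<alpha> \<theta> p \<le> 8 / T}" and ?R = "{q \<in> gap_pairs L. gap_log \<beta> \<xi> q \<le> 9 / T}"
      have "8 / T + 1 / T = 9 / T" by (simp flip: add_divide_distrib)
      then have "Z S \<subseteq> ?P \<times> ?R" using that by (auto simp: Z_def close_gaps_def)
      then have "card (Z S) \<le> card (?P \<times> ?R)" by (intro card_mono) auto
      then have "real (card (Z S)) \<le> real (card ?P) * real (card ?R)"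
        unfolding card_cartesian_product of_nat_mult[symmetric] of_nat_le_iff .
      also have "\<dots> \<le> (6 * (8 / T) * K\<^sup>2 / \<alpha>) * (6 * (9 / T) * L\<^sup>2 / \<beta>)"
        using T0 \<alpha> by (intro mult_mono card_gap_pairs_le K L \<theta> \<xi> \<alpha> \<beta>) auto
      also have "\<dots> = D * (K\<^sup>2 * L\<^sup>2 / T) * (1 / T)" by (simp add: D_def)
      also have "\<dots> \<le> D * (K\<^sup>2 * L\<^sup>2 / T) * 1"
        using T D by (intro mult_left_mono) auto
      also have "\<dots> \<le> D * X"
        unfolding X_def mult_1_right using D K L \<Lambda> by (intro mult_left_mono) auto
      finally show ?thesis .
    qed
    \<comment> \<open>The factor \<open>1 - 1 / 2 ^ n\<close> is the partial sum of the geometric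
      series of the shells removed so far.\<close>
    have halve: "real (card (Z \<alpha>)) \<le> real (card (Z (\<alpha> / 2 ^ n))) + C * X * \<alpha> * (1 - 1 / 2 ^ n)"
      if "4 / T \<le> \<alpha> / 2 ^ n" for n
      using that
    proof (induction n)
      case (Suc n)
      define \<sigma> where "\<sigma> = \<alpha> / 2 ^ Suc n"
      have \<sigma>: "4 / T \<le> \<sigma>" "2 * \<sigma> = \<alpha> / 2 ^ n" "\<sigma> = \<alpha> * (1 / 2 ^ n - 1 / 2 ^ Suc n)" "\<sigma> > 0"
        using Suc.prems \<alpha> by (auto simp: \<sigma>_def field_simps)
      have "\<alpha> / 2 ^ Suc n \<le> \<alpha> / 1"
        using \<alpha> one_le_power[of "2::real" "Suc n"] by (intro divide_left_mono) auto
      then have "\<sigma> \<le> \<alpha>" by (simp add: \<sigma>_def)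
      have "Z (2 * \<sigma>) = Z \<sigma> \<union> {z \<in> close_gaps \<alpha> \<theta> K \<beta> \<xi> L T. \<sigma> \<le> gap_log \<alpha> \<theta> (fst z) \<and> gap_log \<alpha> \<theta> (fst z) < 2 * \<sigma>}"
        using \<sigma>(4) by (auto simp: Z_def)
      then have "real (card (Z (2 * \<sigma>))) \<le> real (card (Z \<sigma>)) +
          real (card {z \<in> close_gaps \<alpha> \<theta> K \<beta> \<xi> L T. \<sigma> \<le> gap_log \<alpha> \<theta> (fst z) \<and> gap_log \<alpha> \<theta> (fst z) < 2 * \<sigma>})"
        unfolding of_nat_add[symmetric] of_nat_le_iff by (simp only: card_Un_le)
      also have "\<dots> \<le> real (card (Z \<sigma>)) + C * \<sigma> * X"
        unfolding X_def by (intro add_left_mono shell K \<theta> L \<xi> T0 \<sigma>(1) \<open>\<sigma> \<le> \<alpha>\<close> \<Lambda>)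
      finally have step: "real (card (Z (\<alpha> / 2 ^ n))) \<le> real (card (Z \<sigma>)) + C * X * \<alpha> * (1 / 2 ^ n - 1 / 2 ^ Suc n)"
        unfolding \<sigma>(2) using \<sigma>(3) by (simp add: mult_ac)
      have "real (card (Z \<alpha>)) \<le> real (card (Z (\<alpha> / 2 ^ n))) + C * X * \<alpha> * (1 - 1 / 2 ^ n)"
        using \<sigma> by (intro Suc.IH) linarith
      also have "\<dots> \<le> real (card (Z \<sigma>)) + C * X * \<alpha> * (1 / 2 ^ n - 1 / 2 ^ Suc n) + C * X * \<alpha> * (1 - 1 / 2 ^ n)"
        using step by simp
      also have "\<dots> = real (card (Z \<sigma>)) + C * X * \<alpha> * (1 - 1 / 2 ^ Suc n)"
        by (simp add: algebra_simps)
      finally show ?case by (simp only: \<sigma>_def)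
    qed simp
    have "\<exists>n. \<alpha> / 2 ^ n \<le> 8 / T"
    proof -
      obtain n where "\<alpha> * T / 8 < 2 ^ n" using real_arch_pow[of 2 "\<alpha> * T / 8"] by auto
      then show ?thesis using T0 by (intro exI[of _ n]) (simp add: field_simps)
    qed
    \<comment> \<open>Minimality puts \<alpha>\<open>/ 2 ^ n\<close> between \<open>4 / T\<close>
      and \<open>8 / T\<close>, unless \<open>n = 0\<close>: large enough for every shell bound,
      small enough for the direct count.\<close>
    define n where "n = (LEAST n. \<alpha> / 2 ^ n \<le> 8 / T)"
    have n: "\<alpha> / 2 ^ n \<le> 8 / T" unfolding n_def by (rule LeastI_ex) fact
    have "real (card (Z \<alpha>)) \<le> D * X + C * X * \<alpha>"
    proof (cases n)
      case 0
      moreover have "0 \<le> C * X * \<alpha>" using C X0 \<alpha> by (intro mult_nonneg_nonneg) auto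
      ultimately show ?thesis using near[of \<alpha>] n by simp
    next
      case (Suc m)
      then have "\<not> \<alpha> / 2 ^ m \<le> 8 / T" using not_less_Least[of m "\<lambda>n. \<alpha> / 2 ^ n \<le> 8 / T"] by (simp add: n_def)
      then have "4 / T \<le> \<alpha> / 2 ^ n" using Suc by (simp add: field_simps)
      then have "real (card (Z \<alpha>)) \<le> real (card (Z (\<alpha> / 2 ^ n))) + C * X * \<alpha> * (1 - 1 / 2 ^ n)"
        by (rule halve)
      also have "\<dots> \<le> D * X + C * X * \<alpha> * 1"
        using n C X0 \<alpha> by (intro add_mono near mult_left_mono) auto
      finally show ?thesis by simp
    qed
    then show "real (card (close_gaps \<alpha> \<theta> K \<beta> \<xi> L T)) \<le> (D + C * \<alpha>) * (K\<^sup>2 * L\<^sup>2 / T + K * L * \<Lambda>)"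
      unfolding all X_def[symmetric] by (simp add: algebra_simps)
  qed
qed

subsection \<open>Mean values of generalized Dirichlet polynomials\<close>

lemma has_integral_triangle_cos:
  fixes \<mu> R :: real
  assumes R: "R > 0"
  shows "((\<lambda>t. (1 - t / R) * cos (\<mu> * t)) has_integral
    (if \<mu> = 0 then R / 2 else (1 - cos (\<mu> * R)) / (\<mu>\<^sup>2 * R))) {0..R}"
proof (cases "\<mu> = 0")
  case True
  have "((\<lambda>t. 1 - t / R) has_integral ((R - R\<^sup>2 / (2 * R)) - (0 - 0\<^sup>2 / (2 * R)))) {0..R}"
  proof (rule fundamental_theorem_of_calculus)
    fix t :: real
    show "((\<lambda>t. t - t\<^sup>2 / (2 * R)) has_vector_derivative 1 - t / R) (at t within {0..R})"
      unfolding has_real_derivative_iff_has_vector_derivative[symmetric]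
      using R by (auto intro!: derivative_eq_intros simp: power2_eq_square)
  qed (use R in simp)
  moreover have "(R - R\<^sup>2 / (2 * R)) - (0 - 0\<^sup>2 / (2 * R)) = R / 2"
    using R by (simp add: power2_eq_square)
  ultimately have "((\<lambda>t. 1 - t / R) has_integral R / 2) {0..R}" by (simp only:)
  then show ?thesis using True by simp
next
  case False
  let ?F = "\<lambda>t. (1 - t / R) * (sin (\<mu> * t) / \<mu>) - cos (\<mu> * t) / (\<mu>\<^sup>2 * R)"
  have "((\<lambda>t. (1 - t / R) * cos (\<mu> * t)) has_integral (?F R - ?F 0)) {0..R}"
  proof (rule fundamental_theorem_of_calculus)
    fix t :: real
    show "(?F has_vector_derivative (1 - t / R) * cos (\<mu> * t)) (at t within {0..R})"
      unfolding has_real_derivative_iff_has_vector_derivative[symmetric]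
      using R False by (auto intro!: derivative_eq_intros simp: power2_eq_square field_simps)
  qed (use R in simp)
  moreover have "?F R - ?F 0 = (1 - cos (\<mu> * R)) / (\<mu>\<^sup>2 * R)"
    using R by (simp add: diff_divide_distrib)
  ultimately show ?thesis using False by simp
qed

text \<open>With \<open>x = (T * \<mu>)\<^sup>2\<close> the left side is
  \<open>T * (sin (T * \<mu>))\<^sup>2 / x\<close> for \<mu> nonzero. Adding
  \<open>(sin (T * \<mu>))\<^sup>2 <= x\<close> to the same bound for \<open>x\<close> times the
  squared sine gives \<open>2 * x\<close> and merges the ranges of small and large \<mu> into one
  decaying kernel.\<close>

lemma triangle_transform_le:
  fixes \<mu> T :: real
  assumes T: "T > 0"
  shows "(if \<mu> = 0 then (2 * T) / 2 else (1 - cos (\<mu> * (2 * T))) / (\<mu>\<^sup>2 * (2 * T))) \<le> 2 * T / (1 + (T * \<mu>)\<^sup>2)"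
proof (cases "\<mu> = 0")
  case False
  define x where "x = (T * \<mu>)\<^sup>2"
  have x: "x > 0" using T False by (simp add: x_def)
  have eq: "(1 - cos (\<mu> * (2 * T))) / (\<mu>\<^sup>2 * (2 * T)) = (sin (T * \<mu>))\<^sup>2 * T / x"
  proof -
    have "1 - cos (\<mu> * (2 * T)) = 2 * (sin (T * \<mu>))\<^sup>2"
      using cos_double_sin[of "T * \<mu>"] by (simp add: mult_ac)
    then show ?thesis using T by (simp add: x_def power2_eq_square)
  qed
  have s1: "(sin (T * \<mu>))\<^sup>2 \<le> 1" by (simp add: abs_square_le_1)
  have s2: "(sin (T * \<mu>))\<^sup>2 \<le> x"
    unfolding x_def using abs_sin_x_le_abs_x[of "T * \<mu>"] by (rule abs_le_square_iff[THEN iffD1])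
  have "(sin (T * \<mu>))\<^sup>2 * x \<le> 1 * x" using s1 x by (intro mult_right_mono) auto
  then have "(sin (T * \<mu>))\<^sup>2 * (1 + x) \<le> 2 * x"
    unfolding distrib_left using s2 by linarith
  then have "(sin (T * \<mu>))\<^sup>2 / x \<le> 2 / (1 + x)" using x by (simp add: field_simps)
  then have "(sin (T * \<mu>))\<^sup>2 / x * T \<le> 2 / (1 + x) * T" using T by (intro mult_right_mono) auto
  then show ?thesis using False unfolding eq by (simp add: x_def)
qed (use T in simp)

section \<open>From a decaying kernel to pairs of close frequencies\<close>

text \<open>On each half-line \<open>1 / (1 + (N + 1)\<^sup>2)\<close> is at most
  \<open>2 / ((N + 1) * (N + 2))\<close>, which telescopes; each half contributes at most 3.\<close>

lemma sum_inverse_square_int_le: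
  fixes D :: "int set"
  assumes "finite D"
  shows "(\<Sum>d\<in>D. 1 / (1 + (real_of_int d)\<^sup>2)) \<le> 6"
proof -
  have half: "(\<Sum>n\<le>N. 1 / (1 + (real n)\<^sup>2)) \<le> 3 - 2 / (real N + 1)" for N
  proof (induction N)
    case (Suc N)
    have "1 / (1 + (real (Suc N))\<^sup>2) \<le> 1 / ((real N + 1) * (real N + 2) / 2)"
      by (intro frac_le) (auto simp: power2_eq_square algebra_simps add_pos_nonneg)
    also have "\<dots> = 2 / (real N + 1) - 2 / (real (Suc N) + 1)"
    proof -
      have "1 / ((x + 1) * (x + 2) / 2) = 2 / (x + 1) - 2 / (x + 2)" if "x \<ge> 0" for x :: real
        using that by (simp add: diff_frac_eq)
      from this[of "real N"] show ?thesis by (simp add: add.commute)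
    qed
    finally show ?case using Suc.IH by simp
  qed simp
  define N where "N = nat (Max (insert 0 (abs ` D)))"
  have N: "\<bar>d\<bar> \<le> int N" if "d \<in> D" for d
    using Max_ge[of "insert 0 (abs ` D)" "\<bar>d\<bar>"] assms that by (simp add: N_def)
  let ?f = "\<lambda>d. 1 / (1 + (real_of_int d)\<^sup>2)"
  have sub: "D \<subseteq> int ` {..N} \<union> (\<lambda>n. - int n) ` {..N}"
  proof
    fix d assume "d \<in> D"
    then have "\<bar>d\<bar> \<le> int N" by (rule N)
    then have "d = int (nat d) \<and> nat d \<le> N \<or> d = - int (nat (- d)) \<and> nat (- d) \<le> N" by linarith
    then show "d \<in> int ` {..N} \<union> (\<lambda>n. - int n) ` {..N}" by blast
  qed
  have f0: "?f d \<ge> 0" for d by (simp add: add_nonneg_nonneg)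
  have "sum ?f D \<le> sum ?f (int ` {..N} \<union> (\<lambda>n. - int n) ` {..N})"
    using sub f0 by (intro sum_mono2) auto
  also have "\<dots> \<le> sum ?f (int ` {..N}) + sum ?f ((\<lambda>n. - int n) ` {..N})"
    using sum_nonneg[of "int ` {..N} \<inter> (\<lambda>n. - int n) ` {..N}" ?f, OF f0]
    by (subst sum_Un) auto
  also have "sum ?f (int ` {..N}) = (\<Sum>n\<le>N. 1 / (1 + (real n)\<^sup>2))"
    by (subst sum.reindex) (simp_all add: inj_on_def)
  also have "sum ?f ((\<lambda>n. - int n) ` {..N}) = (\<Sum>n\<le>N. 1 / (1 + (real n)\<^sup>2))"
    by (subst sum.reindex) (simp_all add: inj_on_def)
  finally have "sum ?f D \<le> 2 * (3 - 2 / (real N + 1))" using half[of N] by simp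
  also have "\<dots> \<le> 6" by simp
  finally show ?thesis .
qed

text \<open>Schur's test for the convolution kernel \<open>1 / (1 + d\<^sup>2)\<close> on the integers.\<close>
lemma sum_kernel_le_card_equal:
  fixes f :: "'a \<Rightarrow> int"
  assumes P: "finite P"
  shows "(\<Sum>p\<in>P. \<Sum>q\<in>P. 1 / (1 + (real_of_int (f p - f q))\<^sup>2))
    \<le> 6 * real (card {(p, q). p \<in> P \<and> q \<in> P \<and> f p = f q})"
proof -
  define n where "n = (\<lambda>i. real (card {p \<in> P. f p = i}))"
  define w where "w = (\<lambda>d. 1 / (1 + (real_of_int d)\<^sup>2))"
  define I where "I = f ` P"
  have fin: "finite I" using P by (simp add: I_def)
  have w0: "w d \<ge> 0" for d by (simp add: w_def)
  have group: "(\<Sum>p\<in>P. g (f p)) = (\<Sum>i\<in>I. n i * g i)" for g :: "int \<Rightarrow> real"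
  proof -
    have "(\<Sum>p\<in>P. g (f p)) = (\<Sum>i\<in>I. \<Sum>p\<in>{p \<in> P. f p = i}. g (f p))"
      unfolding I_def by (rule sum.image_gen[OF P])
    also have "\<dots> = (\<Sum>i\<in>I. \<Sum>p\<in>{p \<in> P. f p = i}. g i)"
      by (intro sum.cong refl) simp
    finally show ?thesis by (simp add: n_def)
  qed
  have row: "(\<Sum>j\<in>I. w (i - j)) \<le> 6" for i
  proof -
    have "(\<Sum>j\<in>I. w (i - j)) = sum w ((\<lambda>j. i - j) ` I)"
      by (subst sum.reindex) (auto simp: inj_on_def)
    also have "\<dots> \<le> 6" unfolding w_def using fin by (intro sum_inverse_square_int_le) simp
    finally show ?thesis .
  qed
  have wsym: "w (i - j) = w (j - i)" for i j by (simp add: w_def power2_commute)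
  have "(\<Sum>p\<in>P. \<Sum>q\<in>P. w (f p - f q)) = (\<Sum>i\<in>I. n i * (\<Sum>j\<in>I. n j * w (i - j)))"
    unfolding group[of "\<lambda>j. w (_ - j)"] by (rule group)
  also have "\<dots> = (\<Sum>i\<in>I. \<Sum>j\<in>I. n i * n j * w (i - j))"
    by (simp add: sum_distrib_left mult_ac)
  also have "\<dots> \<le> (\<Sum>i\<in>I. \<Sum>j\<in>I. ((n i)\<^sup>2 / 2 + (n j)\<^sup>2 / 2) * w (i - j))"
  proof (intro sum_mono mult_right_mono w0)
    fix i j
    show "n i * n j \<le> (n i)\<^sup>2 / 2 + (n j)\<^sup>2 / 2"
      using sum_squares_bound[of "n i" "n j"] by simp
  qed
  also have "\<dots> = (\<Sum>i\<in>I. \<Sum>j\<in>I. (n i)\<^sup>2 / 2 * w (i - j)) + (\<Sum>i\<in>I. \<Sum>j\<in>I. (n j)\<^sup>2 / 2 * w (i - j))"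
    by (simp add: distrib_right sum.distrib)
  also have "(\<Sum>i\<in>I. \<Sum>j\<in>I. (n j)\<^sup>2 / 2 * w (i - j)) = (\<Sum>i\<in>I. \<Sum>j\<in>I. (n i)\<^sup>2 / 2 * w (i - j))"
    by (subst sum.swap) (simp add: wsym)
  also have "(\<Sum>i\<in>I. \<Sum>j\<in>I. (n i)\<^sup>2 / 2 * w (i - j)) + (\<Sum>i\<in>I. \<Sum>j\<in>I. (n i)\<^sup>2 / 2 * w (i - j))
      = (\<Sum>i\<in>I. (n i)\<^sup>2 * (\<Sum>j\<in>I. w (i - j)))"
    by (simp add: sum_distrib_left mult.commute flip: sum.distrib)
  also have "\<dots> \<le> (\<Sum>i\<in>I. (n i)\<^sup>2 * 6)"
    by (intro sum_mono mult_left_mono row) auto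
  also have "\<dots> = 6 * (\<Sum>i\<in>I. n i * n i)" by (simp add: sum_distrib_left power2_eq_square mult_ac)
  also have "(\<Sum>i\<in>I. n i * n i) = (\<Sum>p\<in>P. n (f p))" by (rule group[symmetric])
  also have "\<dots> = real (\<Sum>p\<in>P. card {q \<in> P. f q = f p})" by (simp add: n_def)
  also have "(\<Sum>p\<in>P. card {q \<in> P. f q = f p}) = card (SIGMA p : P. {q \<in> P. f q = f p})"
    using P by (intro card_SigmaI[symmetric]) auto
  also have "(SIGMA p : P. {q \<in> P. f q = f p}) = {(p, q). p \<in> P \<and> q \<in> P \<and> f p = f q}"
    by auto
  finally show ?thesis by (simp add: w_def)
qed

text \<open>Cutting the line into cells of length \<open>1 / T\<close> replaces the kernel by its
  values at integers, at the cost of a factor 4. The tail of the kernel is then absorbed by pairs in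
  a common cell, and these are within \<open>1 / T\<close>.\<close>

lemma sum_poisson_kernel_le_card_close:
  fixes \<omega> :: "'a \<Rightarrow> real"
  assumes P: "finite P" and T: "T > 0"
  shows "(\<Sum>p\<in>P. \<Sum>q\<in>P. 1 / (1 + (T * (\<omega> p - \<omega> q))\<^sup>2))
    \<le> 24 * real (card {(p, q). p \<in> P \<and> q \<in> P \<and> \<bar>\<omega> p - \<omega> q\<bar> \<le> 1 / T})"
proof -
  define f where "f = (\<lambda>p. \<lfloor>T * \<omega> p\<rfloor>)"
  have kernel: "1 / (1 + u\<^sup>2) \<le> 4 * (1 / (1 + (real_of_int d)\<^sup>2))" if "\<bar>u - real_of_int d\<bar> \<le> 1" for u d
  proof -
    \<comment> \<open>Integrality separates the centre from the tail: for
      \<open>\<bar>d\<bar> >= 2\<close> the shift by at most 1 loses at most half of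
      \<open>\<bar>d\<bar>\<close>.\<close>
    have "\<bar>d\<bar> \<le> 1 \<or> \<bar>d\<bar> \<ge> 2" by linarith
    then have "\<bar>real_of_int d\<bar> \<le> 1 \<or> \<bar>real_of_int d\<bar> \<ge> 2"
      unfolding of_int_abs[symmetric] by auto
    then have "(real_of_int d)\<^sup>2 \<le> 4 * u\<^sup>2 + 3"
    proof
      assume "\<bar>real_of_int d\<bar> \<le> 1"
      then have "(real_of_int d)\<^sup>2 \<le> 1" by (simp add: abs_square_le_1)
      then show ?thesis using zero_le_power2[of u] by linarith
    next
      assume "\<bar>real_of_int d\<bar> \<ge> 2"
      then have "\<bar>real_of_int d\<bar> \<le> \<bar>2 * u\<bar>" using that by linarith
      then have "(real_of_int d)\<^sup>2 \<le> (2 * u)\<^sup>2" by (rule abs_le_square_iff[THEN iffD1])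
      then show ?thesis by (simp add: power_mult_distrib)
    qed
    moreover have "0 < 1 + u\<^sup>2" "0 < 1 + (real_of_int d)\<^sup>2" by (auto intro: add_pos_nonneg)
    ultimately show ?thesis by (simp add: field_simps)
  qed
  have "(\<Sum>p\<in>P. \<Sum>q\<in>P. 1 / (1 + (T * (\<omega> p - \<omega> q))\<^sup>2))
      \<le> (\<Sum>p\<in>P. \<Sum>q\<in>P. 4 * (1 / (1 + (real_of_int (f p - f q))\<^sup>2)))"
  proof (intro sum_mono kernel)
    fix p q
    show "\<bar>T * (\<omega> p - \<omega> q) - real_of_int (f p - f q)\<bar> \<le> 1"
      unfolding f_def right_diff_distrib by linarith
  qed
  also have "\<dots> = 4 * (\<Sum>p\<in>P. \<Sum>q\<in>P. 1 / (1 + (real_of_int (f p - f q))\<^sup>2))"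
    by (simp only: sum_distrib_left)
  also have "\<dots> \<le> 4 * (6 * real (card {(p, q). p \<in> P \<and> q \<in> P \<and> f p = f q}))"
    by (intro mult_left_mono sum_kernel_le_card_equal P) simp
  also have "\<dots> \<le> 4 * (6 * real (card {(p, q). p \<in> P \<and> q \<in> P \<and> \<bar>\<omega> p - \<omega> q\<bar> \<le> 1 / T}))"
  proof -
    have "\<bar>\<omega> p - \<omega> q\<bar> \<le> 1 / T" if "f p = f q" for p q
    proof -
      have "\<bar>T * (\<omega> p - \<omega> q)\<bar> \<le> 1" using that unfolding f_def right_diff_distrib by linarith
      then show ?thesis using T unfolding abs_mult by (simp add: field_simps)
    qed
    then have sub: "{(p, q). p \<in> P \<and> q \<in> P \<and> f p = f q} \<subseteq> {(p, q). p \<in> P \<and> q \<in> P \<and> \<bar>\<omega> p - \<omega> q\<bar> \<le> 1 / T}"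
      by blast
    have "finite {(p, q). p \<in> P \<and> q \<in> P \<and> \<bar>\<omega> p - \<omega> q\<bar> \<le> 1 / T}"
      by (rule finite_subset[of _ "P \<times> P"]) (auto simp: P)
    then have "card {(p, q). p \<in> P \<and> q \<in> P \<and> f p = f q} \<le> card {(p, q). p \<in> P \<and> q \<in> P \<and> \<bar>\<omega> p - \<omega> q\<bar> \<le> 1 / T}"
      using sub by (rule card_mono)
    then show ?thesis by simp
  qed
  finally show ?thesis by simp
qed

text \<open>Pairing \<open>t\<close> with \<open>- t\<close> cancels the sines, so a symmetric
  weight on an interval around 0 reduces to cosine integrals over its positive half.\<close>

lemma norm_sum_cis_symmetric:
  "(norm (\<Sum>p\<in>P. c p * cis (\<omega> p * t)))\<^sup>2 + (norm (\<Sum>p\<in>P. c p * cis (\<omega> p * (- t))))\<^sup>2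
    = (\<Sum>p\<in>P. \<Sum>q\<in>P. 2 * Re (c p * cnj (c q)) * cos ((\<omega> p - \<omega> q) * t))"
proof -
  have sq: "(norm (\<Sum>p\<in>P. c p * cis (\<omega> p * t)))\<^sup>2 = (\<Sum>p\<in>P. \<Sum>q\<in>P. Re (c p * cnj (c q) * cis ((\<omega> p - \<omega> q) * t)))" for t
  proof -
    have "complex_of_real ((norm (\<Sum>p\<in>P. c p * cis (\<omega> p * t)))\<^sup>2)
        = (\<Sum>p\<in>P. \<Sum>q\<in>P. c p * cis (\<omega> p * t) * cnj (c q * cis (\<omega> q * t)))"
      unfolding complex_norm_square by (simp add: sum_product cnj_sum)
    also have "\<dots> = (\<Sum>p\<in>P. \<Sum>q\<in>P. c p * cnj (c q) * cis ((\<omega> p - \<omega> q) * t))"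
    proof (intro sum.cong refl)
      fix p q
      have "cis (\<omega> p * t) * cnj (cis (\<omega> q * t)) = cis ((\<omega> p - \<omega> q) * t)"
        by (simp add: cis_cnj cis_mult left_diff_distrib)
      then show "c p * cis (\<omega> p * t) * cnj (c q * cis (\<omega> q * t)) = c p * cnj (c q) * cis ((\<omega> p - \<omega> q) * t)"
        by (simp add: mult_ac)
    qed
    finally have "Re (complex_of_real ((norm (\<Sum>p\<in>P. c p * cis (\<omega> p * t)))\<^sup>2))
        = Re (\<Sum>p\<in>P. \<Sum>q\<in>P. c p * cnj (c q) * cis ((\<omega> p - \<omega> q) * t))" by (rule arg_cong)
    then show ?thesis by (simp only: Re_complex_of_real Re_sum)
  qed
  have "Re (x * cis u) + Re (x * cis (- u)) = 2 * Re x * cos u" for x :: complex and u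
    by simp
  then show ?thesis
    unfolding sq sum.distrib[symmetric] by (simp only: mult_minus_right)
qed

text \<open>The triangular weight on \<open>[-2T, 2T]\<close> is at least \<open>1/2\<close> on \<open>[0, T]\<close> and has a nonnegative
  Fourier transform, which makes the coefficients disappear.\<close>
lemma integral_norm_sum_cis_le:
  fixes \<omega> :: "'a \<Rightarrow> real" and c :: "'a \<Rightarrow> complex"
  assumes P: "finite P" and T: "T > 0" and c: "\<And>p. p \<in> P \<Longrightarrow> norm (c p) \<le> 1"
  shows "integral {0..T} (\<lambda>t. (norm (\<Sum>p\<in>P. c p * cis (\<omega> p * t)))\<^sup>2)
    \<le> 192 * T * real (card {(p, q). p \<in> P \<and> q \<in> P \<and> \<bar>\<omega> p - \<omega> q\<bar> \<le> 1 / T})"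
proof -
  define S where "S = (\<lambda>t. \<Sum>p\<in>P. c p * cis (\<omega> p * t))"
  define k where "k = (\<lambda>\<mu>. if \<mu> = 0 then (2 * T) / 2 else (1 - cos (\<mu> * (2 * T))) / (\<mu>\<^sup>2 * (2 * T)))"
  have k0: "k \<mu> \<ge> 0" for \<mu> using T by (simp add: k_def)
  have k1: "k \<mu> \<le> 2 * T / (1 + (T * \<mu>)\<^sup>2)" for \<mu> unfolding k_def by (rule triangle_transform_le[OF T])
  \<comment> \<open>This is the integrand on \<open>[-2T, 2T]\<close> folded onto the positive half;
    the leading 2 makes up for the weight being as small as \<open>1 / 2\<close> on
    \<open>[0, T]\<close>.\<close>
  define F where "F = (\<lambda>t. 2 * ((1 - t / (2 * T)) * ((norm (S t))\<^sup>2 + (norm (S (- t)))\<^sup>2)))"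
  have cont: "continuous_on A (\<lambda>t. (norm (S t))\<^sup>2)" "continuous_on A (\<lambda>t. (norm (S (- t)))\<^sup>2)" for A
    unfolding S_def by (intro continuous_intros)+
  have contF: "continuous_on A F" for A
    unfolding F_def by (intro continuous_intros cont) (use T in auto)
  have "(F has_integral 2 * (\<Sum>p\<in>P. \<Sum>q\<in>P. 2 * Re (c p * cnj (c q)) * k (\<omega> p - \<omega> q))) {0..2 * T}"
  proof -
    have "((\<lambda>t. 2 * (\<Sum>p\<in>P. \<Sum>q\<in>P. 2 * Re (c p * cnj (c q)) * ((1 - t / (2 * T)) * cos ((\<omega> p - \<omega> q) * t))))
        has_integral 2 * (\<Sum>p\<in>P. \<Sum>q\<in>P. 2 * Re (c p * cnj (c q)) * k (\<omega> p - \<omega> q))) {0..2 * T}"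
      unfolding k_def using T
      by (intro has_integral_mult_right has_integral_sum P has_integral_triangle_cos) auto
    also have "(\<lambda>t. 2 * (\<Sum>p\<in>P. \<Sum>q\<in>P. 2 * Re (c p * cnj (c q)) * ((1 - t / (2 * T)) * cos ((\<omega> p - \<omega> q) * t)))) = F"
      unfolding F_def S_def norm_sum_cis_symmetric by (simp only: sum_distrib_left mult_ac)
    finally show ?thesis .
  qed
  then have intF: "integral {0..2 * T} F = 2 * (\<Sum>p\<in>P. \<Sum>q\<in>P. 2 * Re (c p * cnj (c q)) * k (\<omega> p - \<omega> q))"
    by (rule integral_unique)
  have "integral {0..T} (\<lambda>t. (norm (S t))\<^sup>2) \<le> integral {0..T} F"
  proof (intro integral_le integrable_continuous_real cont contF)
    fix t assume t: "t \<in> {0..T}"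
    have "(norm (S t))\<^sup>2 \<le> 1 * ((norm (S t))\<^sup>2 + (norm (S (- t)))\<^sup>2)" by simp
    also have "\<dots> \<le> (2 * (1 - t / (2 * T))) * ((norm (S t))\<^sup>2 + (norm (S (- t)))\<^sup>2)"
      using t T by (intro mult_right_mono) (auto simp: field_simps)
    finally show "(norm (S t))\<^sup>2 \<le> F t" by (simp only: F_def mult.assoc)
  qed
  also have "\<dots> \<le> integral {0..2 * T} F"
  proof (rule integral_subset_le)
    show "{0..T} \<subseteq> {0..2 * T}" using T by auto
    show "F integrable_on {0..T}" "F integrable_on {0..2 * T}"
      by (rule integrable_continuous_real[OF contF])+
    show "\<forall>t\<in>{0..2 * T}. 0 \<le> F t"
    proof
      fix t assume "t \<in> {0..2 * T}"
      then have "1 - t / (2 * T) \<ge> 0" using T by simp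
      then show "0 \<le> F t" unfolding F_def by simp
    qed
  qed
  also have "\<dots> \<le> 2 * (\<Sum>p\<in>P. \<Sum>q\<in>P. 2 * (2 * T / (1 + (T * (\<omega> p - \<omega> q))\<^sup>2)))"
    unfolding intF
  proof (intro mult_left_mono sum_mono)
    fix p q assume pq: "p \<in> P" "q \<in> P"
    have "Re (c p * cnj (c q)) \<le> norm (c p * cnj (c q))" by (rule complex_Re_le_cmod)
    also have "\<dots> \<le> 1 * 1" unfolding norm_mult using c pq by (intro mult_mono) auto
    finally have "2 * Re (c p * cnj (c q)) * k (\<omega> p - \<omega> q) \<le> 2 * k (\<omega> p - \<omega> q)"
      using k0 by (intro mult_right_mono) auto
    also have "\<dots> \<le> 2 * (2 * T / (1 + (T * (\<omega> p - \<omega> q))\<^sup>2))" using k1[of "\<omega> p - \<omega> q"] by linarith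
    finally show "2 * Re (c p * cnj (c q)) * k (\<omega> p - \<omega> q) \<le> 2 * (2 * T / (1 + (T * (\<omega> p - \<omega> q))\<^sup>2))" .
  qed simp
  also have "\<dots> = 8 * T * (\<Sum>p\<in>P. \<Sum>q\<in>P. 1 / (1 + (T * (\<omega> p - \<omega> q))\<^sup>2))"
    by (simp add: sum_distrib_left)
  also have "\<dots> \<le> 8 * T * (24 * real (card {(p, q). p \<in> P \<and> q \<in> P \<and> \<bar>\<omega> p - \<omega> q\<bar> \<le> 1 / T}))"
    using T by (intro mult_left_mono sum_poisson_kernel_le_card_close P) auto
  finally show ?thesis by (simp add: S_def)
qed

subsection \<open>Close frequencies\<close>

lemma card_dyadic_le:
  assumes "K \<ge> 1"
  shows "real (card (dyadic K)) \<le> 2 * K"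
proof -
  have "dyadic K \<subseteq> {1..nat \<lfloor>2 * K\<rfloor>}"
    using assms by (auto simp: dyadic_def le_nat_floor)
  then have "card (dyadic K) \<le> card {1..nat \<lfloor>2 * K\<rfloor>}" by (intro card_mono) auto
  then have "real (card (dyadic K)) \<le> real (nat \<lfloor>2 * K\<rfloor>)" by simp
  also have "\<dots> \<le> 2 * K" using assms by (intro of_nat_floor) simp
  finally show ?thesis .
qed

text \<open>The Boolean records the orientation, so that ordered pairs of distinct integers are
  recovered from gaps.\<close>

definition gap_ends :: "bool \<Rightarrow> nat \<times> nat \<Rightarrow> nat \<times> nat" where
  "gap_ends s p = (if s then (snd p + fst p, snd p) else (snd p, snd p + fst p))"

lemma dyadic_neq_gap:
  assumes k: "k \<in> dyadic K" "k' \<in> dyadic K" "k \<noteq> k'" and K: "K \<ge> 1" and \<theta>: "\<theta> \<ge> 0" and \<alpha>: "\<alpha> > 0"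
  obtains s p where "p \<in> gap_pairs K" "(k, k') = gap_ends s p"
    "gap_log \<alpha> \<theta> p = \<alpha> * \<bar>ln (real k + \<theta>) - ln (real k' + \<theta>)\<bar>"
proof -
  have pos: "real k + \<theta> > 0" "real k' + \<theta> > 0" using k K \<theta> by (auto simp: dyadic_def)
  have log: "gap_log \<alpha> \<theta> (m - n, n) = \<alpha> * (ln (real m + \<theta>) - ln (real n + \<theta>))"
    if "n < m" "real n + \<theta> > 0" for m n
  proof -
    have "1 + real (m - n) / (real n + \<theta>) = (real m + \<theta>) / (real n + \<theta>)"
      using that by (simp add: field_simps of_nat_diff)
    then show ?thesis using that by (simp add: gap_log_def ln_div)
  qed
  show ?thesis
  proof (cases "k' < k")
    case True
    then have "ln (real k' + \<theta>) \<le> ln (real k + \<theta>)" using pos by simp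
    then show ?thesis
      using True k log[OF True pos(2)] by (intro that[of "(k - k', k')" True]) (auto simp: gap_pairs_def gap_ends_def)
  next
    case False
    then have less: "k < k'" using k by simp
    then have "ln (real k + \<theta>) \<le> ln (real k' + \<theta>)" using pos by simp
    then show ?thesis
      using less k log[OF less pos(1)] by (intro that[of "(k' - k, k)" False]) (auto simp: gap_pairs_def gap_ends_def)
  qed
qed

lemma card_close_diagonal_le:
  fixes \<beta> \<xi> L T :: real
  assumes L: "L \<ge> 1" and \<xi>: "0 \<le> \<xi>" "\<xi> < 1" and \<beta>: "\<beta> > 0" and T: "T > 0"
  shows "finite {(l, l'). l \<in> dyadic L \<and> l' \<in> dyadic L \<and> \<beta> * \<bar>ln (real l + \<xi>) - ln (real l' + \<xi>)\<bar> \<le> 1 / T}"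
    and "real (card {(l, l'). l \<in> dyadic L \<and> l' \<in> dyadic L \<and> \<beta> * \<bar>ln (real l + \<xi>) - ln (real l' + \<xi>)\<bar> \<le> 1 / T})
      \<le> 2 * L + 12 * L\<^sup>2 / (\<beta> * T)"
proof -
  let ?S = "{(l, l'). l \<in> dyadic L \<and> l' \<in> dyadic L \<and> \<beta> * \<bar>ln (real l + \<xi>) - ln (real l' + \<xi>)\<bar> \<le> 1 / T}"
  let ?G = "{p \<in> gap_pairs L. gap_log \<beta> \<xi> p \<le> 1 / T}"
  show "finite ?S" by (rule finite_subset[of _ "dyadic L \<times> dyadic L"]) auto
  have "?S \<subseteq> (\<lambda>l. (l, l)) ` dyadic L \<union> (\<lambda>(s, p). gap_ends s p) ` (UNIV \<times> ?G)"
  proof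
    fix z assume "z \<in> ?S"
    then obtain l l' where z: "z = (l, l')" and l: "l \<in> dyadic L" "l' \<in> dyadic L"
      and c: "\<beta> * \<bar>ln (real l + \<xi>) - ln (real l' + \<xi>)\<bar> \<le> 1 / T" by auto
    show "z \<in> (\<lambda>l. (l, l)) ` dyadic L \<union> (\<lambda>(s, p). gap_ends s p) ` (UNIV \<times> ?G)"
    proof (cases "l = l'")
      case True
      then show ?thesis using z l by auto
    next
      case False
      obtain s p where "p \<in> gap_pairs L" "(l, l') = gap_ends s p"
        "gap_log \<beta> \<xi> p = \<beta> * \<bar>ln (real l + \<xi>) - ln (real l' + \<xi>)\<bar>"
        using dyadic_neq_gap[OF l False L \<xi>(1) \<beta>] .
      then have "(s, p) \<in> UNIV \<times> ?G" "z = (\<lambda>(s, p). gap_ends s p) (s, p)" using c z by auto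
      then show ?thesis by (metis (no_types, lifting) UnI2 image_eqI)
    qed
  qed
  then have "card ?S \<le> card ((\<lambda>l. (l, l)) ` dyadic L \<union> (\<lambda>(s, p). gap_ends s p) ` (UNIV \<times> ?G))"
    by (intro card_mono) auto
  also have "\<dots> \<le> card ((\<lambda>l. (l, l)) ` dyadic L) + card ((\<lambda>(s, p). gap_ends s p) ` (UNIV \<times> ?G))"
    by (rule card_Un_le)
  also have "\<dots> \<le> card (dyadic L) + card ((UNIV :: bool set) \<times> ?G)"
    by (intro add_mono card_image_le) auto
  also have "card ((UNIV :: bool set) \<times> ?G) = 2 * card ?G" by (simp add: card_cartesian_product)
  finally have "real (card ?S) \<le> real (card (dyadic L) + 2 * card ?G)" by (simp only: of_nat_le_iff)
  also have "\<dots> = real (card (dyadic L)) + 2 * real (card ?G)" by simp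
  also have "\<dots> \<le> 2 * L + 2 * (6 * (1 / T) * L\<^sup>2 / \<beta>)"
    using T by (intro add_mono mult_left_mono card_dyadic_le card_gap_pairs_le L \<xi> \<beta>) auto
  finally show "real (card ?S) \<le> 2 * L + 12 * L\<^sup>2 / (\<beta> * T)" by (simp add: mult.commute)
qed

section \<open>Reduction of close frequencies to close gaps\<close>

definition frequency :: "real \<Rightarrow> real \<Rightarrow> real \<Rightarrow> real \<Rightarrow> nat \<times> nat \<Rightarrow> real" where
  "frequency \<alpha> \<theta> \<beta> \<xi> x = \<alpha> * ln (real (fst x) + \<theta>) + \<beta> * ln (real (snd x) + \<xi>)"

definition close_frequencies ::
  "real \<Rightarrow> real \<Rightarrow> real \<Rightarrow> real \<Rightarrow> real \<Rightarrow> real \<Rightarrow> real \<Rightarrow> ((nat \<times> nat) \<times> (nat \<times> nat)) set" where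
  "close_frequencies \<alpha> \<theta> K \<beta> \<xi> L T = {(x, y). x \<in> dyadic K \<times> dyadic L \<and> y \<in> dyadic K \<times> dyadic L \<and>
     \<bar>frequency \<alpha> \<theta> \<beta> \<xi> x - frequency \<alpha> \<theta> \<beta> \<xi> y\<bar> \<le> 1 / T}"

text \<open>The reverse triangle inequality discards the signs of \<alpha>, \<beta> and of the two
  differences, reducing to positive parameters. Pairs with a common coordinate give the first two
  terms; the others come from close gaps, each with four orientations.\<close>

lemma card_close_frequencies_le_gaps:
  fixes \<alpha> \<beta> \<theta> \<xi> K L T :: real
  assumes \<alpha>: "\<alpha> \<noteq> 0" and \<beta>: "\<beta> \<noteq> 0" and K: "K \<ge> 1" and \<theta>: "0 \<le> \<theta>" "\<theta> < 1"
    and L: "L \<ge> 1" and \<xi>: "0 \<le> \<xi>" "\<xi> < 1" and T: "T > 0"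
  shows "real (card (close_frequencies \<alpha> \<theta> K \<beta> \<xi> L T))
    \<le> 2 * K * (2 * L + 12 * L\<^sup>2 / (\<bar>\<beta>\<bar> * T)) + 2 * L * (2 * K + 12 * K\<^sup>2 / (\<bar>\<alpha>\<bar> * T))
      + 4 * real (card (close_gaps \<bar>\<alpha>\<bar> \<theta> K \<bar>\<beta>\<bar> \<xi> L T))"
proof -
  have a0: "\<bar>\<alpha>\<bar> > 0" and b0: "\<bar>\<beta>\<bar> > 0" using \<alpha> \<beta> by auto
  let ?DL = "{(l, l'). l \<in> dyadic L \<and> l' \<in> dyadic L \<and> \<bar>\<beta>\<bar> * \<bar>ln (real l + \<xi>) - ln (real l' + \<xi>)\<bar> \<le> 1 / T}"
  let ?DK = "{(k, k'). k \<in> dyadic K \<and> k' \<in> dyadic K \<and> \<bar>\<alpha>\<bar> * \<bar>ln (real k + \<theta>) - ln (real k' + \<theta>)\<bar> \<le> 1 / T}"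
  let ?G = "close_gaps \<bar>\<alpha>\<bar> \<theta> K \<bar>\<beta>\<bar> \<xi> L T"
  note DL = card_close_diagonal_le[OF L \<xi> b0 T] and DK = card_close_diagonal_le[OF K \<theta> a0 T]
  define f1 where "f1 = (\<lambda>(k, (l, l')). ((k, l), (k, l')) :: (nat \<times> nat) \<times> (nat \<times> nat))"
  define f2 where "f2 = (\<lambda>(l, (k, k')). ((k, l), (k', l)) :: (nat \<times> nat) \<times> (nat \<times> nat))"
  define f3 where "f3 = (\<lambda>((s, t), (p, q)). ((fst (gap_ends s p), fst (gap_ends t q)), (snd (gap_ends s p), snd (gap_ends t q))))"
  let ?A = "f1 ` (dyadic K \<times> ?DL)" and ?B = "f2 ` (dyadic L \<times> ?DK)" and ?C = "f3 ` (UNIV \<times> ?G)"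
  have "close_frequencies \<alpha> \<theta> K \<beta> \<xi> L T \<subseteq> ?A \<union> ?B \<union> ?C"
  proof
    fix z assume "z \<in> close_frequencies \<alpha> \<theta> K \<beta> \<xi> L T"
    then obtain k l k' l' where z: "z = ((k, l), (k', l'))"
      and kl: "k \<in> dyadic K" "k' \<in> dyadic K" "l \<in> dyadic L" "l' \<in> dyadic L"
      and close: "\<bar>frequency \<alpha> \<theta> \<beta> \<xi> (k, l) - frequency \<alpha> \<theta> \<beta> \<xi> (k', l')\<bar> \<le> 1 / T"
      by (auto simp: close_frequencies_def)
    define u where "u = ln (real k + \<theta>) - ln (real k' + \<theta>)"
    define v where "v = ln (real l + \<xi>) - ln (real l' + \<xi>)"
    have "\<bar>\<alpha> * u + \<beta> * v\<bar> \<le> 1 / T"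
      using close by (simp add: frequency_def u_def v_def algebra_simps)
    moreover have "\<bar>\<bar>\<alpha>\<bar> * \<bar>u\<bar> - \<bar>\<beta>\<bar> * \<bar>v\<bar>\<bar> \<le> \<bar>\<alpha> * u + \<beta> * v\<bar>"
      unfolding abs_mult[symmetric] by linarith
    ultimately have uv: "\<bar>\<bar>\<alpha>\<bar> * \<bar>u\<bar> - \<bar>\<beta>\<bar> * \<bar>v\<bar>\<bar> \<le> 1 / T" by linarith
    consider "k = k'" | "l = l'" | "k \<noteq> k'" "l \<noteq> l'" by blast
    then show "z \<in> ?A \<union> ?B \<union> ?C"
    proof cases
      case 1
      then have "(k, (l, l')) \<in> dyadic K \<times> ?DL" using uv kl by (simp add: u_def v_def)
      moreover have "z = f1 (k, (l, l'))" using z 1 by (simp add: f1_def)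
      ultimately show ?thesis by blast
    next
      case 2
      then have "(l, (k, k')) \<in> dyadic L \<times> ?DK" using uv kl by (simp add: u_def v_def)
      moreover have "z = f2 (l, (k, k'))" using z 2 by (simp add: f2_def)
      ultimately show ?thesis by blast
    next
      case 3
      obtain s p where p: "p \<in> gap_pairs K" "(k, k') = gap_ends s p" "gap_log \<bar>\<alpha>\<bar> \<theta> p = \<bar>\<alpha>\<bar> * \<bar>u\<bar>"
        unfolding u_def using dyadic_neq_gap[OF kl(1,2) 3(1) K \<theta>(1) a0] .
      obtain t q where q: "q \<in> gap_pairs L" "(l, l') = gap_ends t q" "gap_log \<bar>\<beta>\<bar> \<xi> q = \<bar>\<beta>\<bar> * \<bar>v\<bar>"
        unfolding v_def using dyadic_neq_gap[OF kl(3,4) 3(2) L \<xi>(1) b0] .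
      have "((s, t), (p, q)) \<in> UNIV \<times> ?G" using p q uv by (simp add: close_gaps_def)
      moreover have "z = f3 ((s, t), (p, q))"
        using z by (simp add: f3_def p(2)[symmetric] q(2)[symmetric])
      ultimately show ?thesis by blast
    qed
  qed
  then have "card (close_frequencies \<alpha> \<theta> K \<beta> \<xi> L T) \<le> card (?A \<union> ?B \<union> ?C)"
    using DL(1) DK(1) by (intro card_mono finite_UnI finite_imageI finite_cartesian_product) auto
  also have "\<dots> \<le> card ?A + card ?B + card ?C"
    using card_Un_le[of "?A \<union> ?B" ?C] card_Un_le[of ?A ?B] by linarith
  also have "\<dots> \<le> card (dyadic K \<times> ?DL) + card (dyadic L \<times> ?DK) + card ((UNIV :: (bool \<times> bool) set) \<times> ?G)"
    using DL(1) DK(1) by (intro add_mono card_image_le finite_cartesian_product) auto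
  also have "\<dots> = card (dyadic K) * card ?DL + card (dyadic L) * card ?DK + 4 * card ?G"
    by (simp add: card_cartesian_product card_UNIV_bool flip: UNIV_Times_UNIV)
  finally have "real (card (close_frequencies \<alpha> \<theta> K \<beta> \<xi> L T))
      \<le> real (card (dyadic K)) * real (card ?DL) + real (card (dyadic L)) * real (card ?DK) + 4 * real (card ?G)"
    by (metis (no_types, lifting) of_nat_add of_nat_le_iff of_nat_mult of_nat_numeral)
  also have "\<dots> \<le> 2 * K * (2 * L + 12 * L\<^sup>2 / (\<bar>\<beta>\<bar> * T)) + 2 * L * (2 * K + 12 * K\<^sup>2 / (\<bar>\<alpha>\<bar> * T))
      + 4 * real (card ?G)"
    using K L by (intro add_mono mult_mono card_dyadic_le DL(2) DK(2)) auto
  finally show ?thesis .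
qed

lemma card_close_frequencies_le:
  fixes \<alpha> \<beta> :: real
  assumes \<alpha>: "\<alpha> \<noteq> 0" and \<beta>: "\<beta> \<noteq> 0"
  shows "\<exists>C>0. \<forall>K \<theta> L \<xi> T. K \<ge> 1 \<longrightarrow> 0 \<le> \<theta> \<longrightarrow> \<theta> < 1 \<longrightarrow> L \<ge> 1 \<longrightarrow> 0 \<le> \<xi> \<longrightarrow> \<xi> < 1 \<longrightarrow> T \<ge> 1 \<longrightarrow>
      real (card (close_frequencies \<alpha> \<theta> K \<beta> \<xi> L T)) \<le> C * (K\<^sup>2 * L\<^sup>2 / T + K * L) * ln (max 2 T)"
proof -
  have a0: "\<bar>\<alpha>\<bar> > 0" and b0: "\<bar>\<beta>\<bar> > 0" using \<alpha> \<beta> by auto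
  obtain C where C: "C > 0" and gaps: "\<And>K \<theta> L \<xi> T \<Lambda>. K \<ge> 1 \<Longrightarrow> 0 \<le> \<theta> \<Longrightarrow> \<theta> < 1 \<Longrightarrow> L \<ge> 1 \<Longrightarrow> 0 \<le> \<xi> \<Longrightarrow> \<xi> < 1 \<Longrightarrow>
      T \<ge> 1 \<Longrightarrow> 1 \<le> \<Lambda> \<Longrightarrow> 1 + ln (\<bar>\<alpha>\<bar> * T / 2) \<le> \<Lambda> \<Longrightarrow> 1 + ln (\<bar>\<beta>\<bar> * T / 2) \<le> \<Lambda> \<Longrightarrow>
      real (card (close_gaps \<bar>\<alpha>\<bar> \<theta> K \<bar>\<beta>\<bar> \<xi> L T)) \<le> C * (K\<^sup>2 * L\<^sup>2 / T + K * L * \<Lambda>)"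
    using card_close_gaps_le[OF a0 b0] by blast
  define c where "c = 1 + \<bar>ln \<bar>\<alpha>\<bar>\<bar> + \<bar>ln \<bar>\<beta>\<bar>\<bar>"
  \<comment> \<open>Chosen so that \<open>A * ln (max 2 T)\<close> exceeds
    \<open>c + ln (max 2 T)\<close>: since \<open>ln (max 2 T) >= ln 2\<close>, a multiple of the
    logarithm absorbs the constants depending on \<alpha> and \<beta>.\<close>
  define A where "A = c / ln 2 + 1"
  define D where "D = 8 + 24 / \<bar>\<alpha>\<bar> + 24 / \<bar>\<beta>\<bar> + 4 * C"
  have c: "c \<ge> 1" by (simp add: c_def)
  have A: "A \<ge> 1" using c by (simp add: A_def)
  have D: "D > 0" using C a0 b0 by (simp add: D_def add_pos_nonneg add_nonneg_pos)
  show ?thesis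
  proof (intro exI[of _ "D * A"] conjI allI impI)
    show "D * A > 0" using A D by (intro mult_pos_pos) auto
    fix K \<theta> L \<xi> T :: real
    assume K: "K \<ge> 1" and \<theta>: "0 \<le> \<theta>" "\<theta> < 1" and L: "L \<ge> 1" and \<xi>: "0 \<le> \<xi>" "\<xi> < 1" and T: "T \<ge> 1"
    define \<Lambda> where "\<Lambda> = A * ln (max 2 T)"
    have ln2: "ln 2 > (0::real)" "ln 2 \<le> ln (max 2 T)" "ln T \<le> ln (max 2 T)" using T by auto
    have "\<Lambda> = c * (ln (max 2 T) / ln 2) + ln (max 2 T)"
      by (simp add: \<Lambda>_def A_def distrib_right)
    moreover have "c * 1 \<le> c * (ln (max 2 T) / ln 2)" using ln2 c by (intro mult_left_mono) auto
    ultimately have \<Lambda>: "\<Lambda> \<ge> c + ln (max 2 T)" by simp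
    have \<Lambda>1: "1 \<le> \<Lambda>" using \<Lambda> c ln2 by linarith
    have \<Lambda>': "1 + ln (\<bar>x\<bar> * T / 2) \<le> \<Lambda>" if "x \<noteq> 0" "\<bar>ln \<bar>x\<bar>\<bar> \<le> c - 1" for x
    proof -
      have "ln (\<bar>x\<bar> * T / 2) = ln \<bar>x\<bar> + ln T - ln 2" using that T by (simp add: ln_div ln_mult)
      then show ?thesis using that \<Lambda> ln2 by linarith
    qed
    have X: "K * L \<ge> 0" "K\<^sup>2 * L\<^sup>2 / T \<ge> 0" using K L T by auto
    \<comment> \<open>As \<open>K\<close> and \<open>L\<close> are at least 1, the pairs sharing one
      coordinate are dominated by the generic term.\<close>
    have "K * L\<^sup>2 \<le> K\<^sup>2 * L\<^sup>2" "L * K\<^sup>2 \<le> K\<^sup>2 * L\<^sup>2"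
      using K L mult_right_mono[of 1 K "K * L\<^sup>2"] mult_right_mono[of 1 L "L * K\<^sup>2"]
      by (simp_all add: power2_eq_square mult_ac)
    then have mixed: "K * L\<^sup>2 / T \<le> K\<^sup>2 * L\<^sup>2 / T" "L * K\<^sup>2 / T \<le> K\<^sup>2 * L\<^sup>2 / T"
      using T by (auto intro: divide_right_mono)
    let ?G = "close_gaps \<bar>\<alpha>\<bar> \<theta> K \<bar>\<beta>\<bar> \<xi> L T"
    have "real (card (close_frequencies \<alpha> \<theta> K \<beta> \<xi> L T))
        \<le> 2 * K * (2 * L + 12 * L\<^sup>2 / (\<bar>\<beta>\<bar> * T)) + 2 * L * (2 * K + 12 * K\<^sup>2 / (\<bar>\<alpha>\<bar> * T)) + 4 * real (card ?G)"
      using T by (intro card_close_frequencies_le_gaps \<alpha> \<beta> K \<theta> L \<xi>) auto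
    also have "\<dots> = 8 * (K * L) + 24 / \<bar>\<beta>\<bar> * (K * L\<^sup>2 / T) + 24 / \<bar>\<alpha>\<bar> * (L * K\<^sup>2 / T) + 4 * real (card ?G)"
      by (simp add: algebra_simps)
    also have "\<dots> \<le> 8 * (K * L) + 24 / \<bar>\<beta>\<bar> * (K\<^sup>2 * L\<^sup>2 / T) + 24 / \<bar>\<alpha>\<bar> * (K\<^sup>2 * L\<^sup>2 / T)
        + 4 * (C * (K\<^sup>2 * L\<^sup>2 / T + K * L * \<Lambda>))"
    proof (intro add_mono mult_left_mono mixed order_refl gaps K \<theta> L \<xi> T \<Lambda>1)
      show "1 + ln (\<bar>\<alpha>\<bar> * T / 2) \<le> \<Lambda>" "1 + ln (\<bar>\<beta>\<bar> * T / 2) \<le> \<Lambda>"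
        using \<alpha> \<beta> by (auto intro!: \<Lambda>' simp: c_def)
    qed (use K L in auto)
    also have "\<dots> \<le> 8 * ((K\<^sup>2 * L\<^sup>2 / T + K * L) * \<Lambda>) + 24 / \<bar>\<beta>\<bar> * ((K\<^sup>2 * L\<^sup>2 / T + K * L) * \<Lambda>)
        + 24 / \<bar>\<alpha>\<bar> * ((K\<^sup>2 * L\<^sup>2 / T + K * L) * \<Lambda>) + 4 * (C * ((K\<^sup>2 * L\<^sup>2 / T + K * L) * \<Lambda>))"
    proof -
      have "K * L \<le> K * L * \<Lambda>" "K\<^sup>2 * L\<^sup>2 / T \<le> K\<^sup>2 * L\<^sup>2 / T * \<Lambda>"
        using X \<Lambda>1 mult_left_mono[OF \<Lambda>1 X(1)] mult_left_mono[OF \<Lambda>1 X(2)] by simp_all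
      then have "K * L \<le> (K\<^sup>2 * L\<^sup>2 / T + K * L) * \<Lambda>" "K\<^sup>2 * L\<^sup>2 / T \<le> (K\<^sup>2 * L\<^sup>2 / T + K * L) * \<Lambda>"
        "K\<^sup>2 * L\<^sup>2 / T + K * L * \<Lambda> \<le> (K\<^sup>2 * L\<^sup>2 / T + K * L) * \<Lambda>"
        unfolding distrib_right using X \<Lambda>1 by linarith+
      then show ?thesis using C by (intro add_mono mult_left_mono) auto
    qed
    also have "\<dots> = D * ((K\<^sup>2 * L\<^sup>2 / T + K * L) * \<Lambda>)"
      by (simp only: D_def distrib_right mult.assoc)
    also have "\<dots> = D * A * (K\<^sup>2 * L\<^sup>2 / T + K * L) * ln (max 2 T)" by (simp add: \<Lambda>_def)
    finally show "real (card (close_frequencies \<alpha> \<theta> K \<beta> \<xi> L T)) \<le> D * A * (K\<^sup>2 * L\<^sup>2 / T + K * L) * ln (max 2 T)" .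
  qed
qed

lemma dirichlet_sum_product:
  assumes K: "K \<ge> 1" and \<theta>: "0 \<le> \<theta>" and L: "L \<ge> 1" and \<xi>: "0 \<le> \<xi>"
  shows "dirichlet_sum \<theta> \<alpha> K a t * dirichlet_sum \<xi> \<beta> L b t
    = (\<Sum>x\<in>dyadic K \<times> dyadic L. a (fst x) * b (snd x) * cis (frequency \<alpha> \<theta> \<beta> \<xi> x * t))"
proof -
  have cis: "complex_of_real (real n + \<theta>) powr (\<i> * of_real (\<alpha> * t)) = cis (\<alpha> * ln (real n + \<theta>) * t)"
    if "n \<in> dyadic N" "N \<ge> 1" "\<theta> \<ge> 0" for n N \<theta> \<alpha>
  proof -
    have pos: "real n + \<theta> > 0" using that by (auto simp: dyadic_def)
    then have "complex_of_real (real n + \<theta>) powr (\<i> * of_real (\<alpha> * t)) = exp (\<i> * of_real (\<alpha> * t) * of_real (ln (real n + \<theta>)))"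
      by (simp add: powr_def Ln_of_real del: of_real_add)
    also have "\<dots> = cis (\<alpha> * ln (real n + \<theta>) * t)" by (simp add: cis_conv_exp mult_ac)
    finally show ?thesis .
  qed
  show ?thesis
    unfolding dirichlet_sum_def sum_product sum.cartesian_product
  proof (intro sum.cong refl, clarify)
    fix k l assume kl: "k \<in> dyadic K" "l \<in> dyadic L"
    have split: "cis (frequency \<alpha> \<theta> \<beta> \<xi> (k, l) * t) = cis (\<alpha> * ln (real k + \<theta>) * t) * cis (\<beta> * ln (real l + \<xi>) * t)"
      by (simp add: frequency_def distrib_right cis_mult)
    show "a k * complex_of_real (real k + \<theta>) powr (\<i> * of_real (\<alpha> * t)) *
        (b l * complex_of_real (real l + \<xi>) powr (\<i> * of_real (\<beta> * t)))
      = a (fst (k, l)) * b (snd (k, l)) * cis (frequency \<alpha> \<theta> \<beta> \<xi> (k, l) * t)"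
      unfolding cis[OF kl(1) K \<theta>] cis[OF kl(2) L \<xi>]
      unfolding split fst_conv snd_conv by (simp only: mult_ac)
  qed
qed

theorem theorem3:
  fixes \<alpha> \<beta> :: real
  assumes "\<alpha> * \<beta> \<noteq> 0"
  shows "\<exists>C>0. \<forall>(\<theta>::real) (\<xi>::real) (T::real) (K::real) (L::real)
           (a :: nat \<Rightarrow> complex) (b :: nat \<Rightarrow> complex).
           0 \<le> \<theta> \<longrightarrow> \<theta> < 1 \<longrightarrow> 0 \<le> \<xi> \<longrightarrow> \<xi> < 1 \<longrightarrow>
           T \<ge> 1 \<longrightarrow> K \<ge> 1 \<longrightarrow> L \<ge> 1 \<longrightarrow>
           (\<forall>k. norm (a k) \<le> 1) \<longrightarrow> (\<forall>l. norm (b l) \<le> 1) \<longrightarrow>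
           integral {0..T} (\<lambda>t. (norm (dirichlet_sum \<theta> \<alpha> K a t))\<^sup>2 *
                                 (norm (dirichlet_sum \<xi> \<beta> L b t))\<^sup>2)
             \<le> C * ((T + K * L) * (K * L) * (ln (max 2 T)) ^ 15)"
proof -
  have \<alpha>: "\<alpha> \<noteq> 0" and \<beta>: "\<beta> \<noteq> 0" using assms by auto
  obtain C where C: "C > 0" and count: "\<And>K \<theta> L \<xi> T. K \<ge> 1 \<Longrightarrow> 0 \<le> \<theta> \<Longrightarrow> \<theta> < 1 \<Longrightarrow> L \<ge> 1 \<Longrightarrow> 0 \<le> \<xi> \<Longrightarrow> \<xi> < 1 \<Longrightarrow>
      T \<ge> 1 \<Longrightarrow> real (card (close_frequencies \<alpha> \<theta> K \<beta> \<xi> L T)) \<le> C * (K\<^sup>2 * L\<^sup>2 / T + K * L) * ln (max 2 T)"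
    using card_close_frequencies_le[OF \<alpha> \<beta>] by blast
  show ?thesis
  \<comment> \<open>The argument yields the first power of the logarithm; since
    \<open>ln (max 2 T) >= ln 2\<close>, fourteen further powers cost the constant
    \<open>1 / (ln 2) ^ 14\<close>.\<close>
  proof (intro exI[of _ "192 * C / (ln 2) ^ 14"] conjI allI impI)
    show "192 * C / (ln 2) ^ 14 > 0" using C by simp
    fix \<theta> \<xi> T K L :: real and a b :: "nat \<Rightarrow> complex"
    assume \<theta>: "0 \<le> \<theta>" "\<theta> < 1" and \<xi>: "0 \<le> \<xi>" "\<xi> < 1" and T: "T \<ge> 1" and K: "K \<ge> 1" and L: "L \<ge> 1"
      and a: "\<forall>k. norm (a k) \<le> 1" and b: "\<forall>l. norm (b l) \<le> 1"
    let ?P = "dyadic K \<times> dyadic L"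
    define l where "l = ln (max 2 T)"
    have l: "ln 2 \<le> l" "(0::real) < ln 2" "0 \<le> l" by (auto simp: l_def)
    have "(norm (dirichlet_sum \<theta> \<alpha> K a t))\<^sup>2 * (norm (dirichlet_sum \<xi> \<beta> L b t))\<^sup>2
        = (norm (\<Sum>x\<in>?P. a (fst x) * b (snd x) * cis (frequency \<alpha> \<theta> \<beta> \<xi> x * t)))\<^sup>2" for t
      by (simp only: dirichlet_sum_product[OF K \<theta>(1) L \<xi>(1), symmetric] norm_mult power_mult_distrib)
    then have "integral {0..T} (\<lambda>t. (norm (dirichlet_sum \<theta> \<alpha> K a t))\<^sup>2 * (norm (dirichlet_sum \<xi> \<beta> L b t))\<^sup>2)
        = integral {0..T} (\<lambda>t. (norm (\<Sum>x\<in>?P. a (fst x) * b (snd x) * cis (frequency \<alpha> \<theta> \<beta> \<xi> x * t)))\<^sup>2)"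
      by simp
    also have "\<dots> \<le> 192 * T * real (card {(x, y). x \<in> ?P \<and> y \<in> ?P \<and>
        \<bar>frequency \<alpha> \<theta> \<beta> \<xi> x - frequency \<alpha> \<theta> \<beta> \<xi> y\<bar> \<le> 1 / T})"
    proof (rule integral_norm_sum_cis_le)
      show "norm (a (fst x) * b (snd x)) \<le> 1" for x
        using a b mult_mono[of "norm (a (fst x))" 1 "norm (b (snd x))" 1] by (simp add: norm_mult)
    qed (use T in auto)
    also have "\<dots> \<le> 192 * T * (C * (K\<^sup>2 * L\<^sup>2 / T + K * L) * l)"
      using count[OF K \<theta> L \<xi> T] T
      unfolding close_frequencies_def l_def by (intro mult_left_mono) auto
    also have "\<dots> = 192 * C * ((T + K * L) * (K * L)) * l"
      using T by (simp add: power2_eq_square field_simps)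
    also have "\<dots> \<le> 192 * C * ((T + K * L) * (K * L)) * (l ^ 15 / (ln 2) ^ 14)"
    proof (rule mult_left_mono)
      have "(ln 2) ^ 14 * l \<le> l ^ 14 * l" using l by (intro mult_right_mono power_mono) auto
      also have "\<dots> = l ^ 15" by (simp add: eval_nat_numeral)
      finally show "l \<le> l ^ 15 / (ln 2) ^ 14" using l by (simp add: pos_le_divide_eq mult.commute)
      show "0 \<le> 192 * C * ((T + K * L) * (K * L))" using C K L T by simp
    qed
    finally show "integral {0..T} (\<lambda>t. (norm (dirichlet_sum \<theta> \<alpha> K a t))\<^sup>2 * (norm (dirichlet_sum \<xi> \<beta> L b t))\<^sup>2)
        \<le> 192 * C / (ln 2) ^ 14 * ((T + K * L) * (K * L) * (ln (max 2 T)) ^ 15)"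
      by (simp add: l_def)
  qed
qed

end
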